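(* Let $T$ be a semi-infinite banded stochastic matrix ($p$ subdiagonals, $q$ superdiagonals) admitting a positive bidiagonal factorization (equivalently, a stochastic bidiagonal factorization), let $A^{(a)}_n$, $B^{(b)}_n$ be its left and right recursion polynomials for an appropriate (positivity-guaranteeing) choice of initial conditions, and let $(\mathrm d\psi_{b,a})_{1\le b\le q,1\le a\le p}$ be the associated matrix of positive measures on $[0,1]$. For the Markov chain on $\mathbb N_0$ with transition matrix $T$: 1. for all $k\in\mathbb N_0$, $n,m\in\mathbb N_0$, $$(T^k)_{n,m}=\sum_{a=1}^p\sum_{b=1}^{q}\int_0^1B^{(b)}_n(x)\,x^k\,\mathrm d\psi_{b,a}(x)\,A^{(a)}_{m}(x);$$ 2. for $|s|<1$ the transition probability generating functions are $$(T(s))_{n,m}=\sum_{a=1}^p\sum_{b=1}^{q}\int_0^1B^{(b)}_n(x)\,\frac{\mathrm d\psi_{b,a}(x)}{1-sx}\,A^{(a)}_{m}(x);$$ 3. for $|s|<1$ and $n\ne m$ the first passage generating functions are $$(F(s))_{n,m}=\frac{\sum_{a=1}^p\sum_{b=1}^{q}\int_0^1B^{(b)}_n(x)\frac{\mathrm d\psi_{b,a}(x)}{1-sx}A^{(a)}_{m}(x)}{\sum_{a=1}^p\sum_{b=1}^{q}\int_0^1B^{(b)}_m(x)\frac{\mathrm d\psi_{b,a}(x)}{1-sx}A^{(a)}_{m}(x)};$$ 4. for $|s|<1$ and $n=m$, $$(F(s))_{m}=1-\frac{1}{\sum_{a=1}^p\sum_{b=1}^{q}\int_0^1B^{(b)}_m(x)\frac{\mathrm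 d\psi_{b,a}(x)}{1-sx}A^{(a)}_{m}(x)}.$$
   Context: Generating functions: $(T(s))_{n,m}=\sum_{r\ge0}(T^r)_{n,m}s^r$; $(F(s))_{n,m}=\sum_{r\ge1}f^r_{n,m}s^r$ with $f^r_{n,m}=\Pr(X_r=m,X_{r-1}\ne m,\dots,X_1\ne m\mid X_0=n)$ for the chain $(X_r)$ with transition matrix $T$; $(F(s))_m=(F(s))_{m,m}$. Semi-infinite matrices are indexed by $\mathbb N_0$. $p,q\ge1$ are integers. $T$ is stochastic (nonnegative entries, rows sum to $1$) and banded: $T_{n,m}=0$ unless $n-p\le m\le n+q$, with positive entries inside the band. A positive bidiagonal factorization is $T=\mathscr L_1\cdots\mathscr L_p\mathscr U_q\cdots\mathscr U_1$ with each $\mathscr L_i$ lower bidiagonal with positive main diagonal and first subdiagonal, and each $\mathscr U_j$ upper bidiagonal with positive main diagonal and first superdiagonal (all other entries zero); it is a stochastic bidiagonal factorization if moreover all factors are stochastic. $T^{[N]}=(T_{n,m})_{n,m=0}^N$; its eigenvalues $\lambda_0^{[N]}>\dots>\lambda_N^{[N]}$ are simple and lie in $(0,1)$ (known). Recursion polynomials. Let $\nu\in\mathbb R^{p\times p}$ and $\xi\in\mathbb R^{q\times q}$ be real unitriangular lower matrices (ones on the diagonal, zeros above; the initial conditions). For $a\in\{1,\dots,p\}$, the polynomials $A^{(a)}_n(x)$, $n\ge0$, are determined by $A^{(a)}_n=\nu_{n+1,a}$ for $0\le n\le p-1$ and $\sum_{l\ge0}A^{(a)}_l T_{l,n}=xA^{(a)}_n$,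 $n\ge0$. For $b\in\{1,\dots,q\}$, $B^{(b)}_n(x)$ are determined by $B^{(b)}_n=\xi_{n+1,b}$ for $0\le n\le q-1$ and $\sum_{l\ge0}T_{n,l}B^{(b)}_l=xB^{(b)}_n$, $n\ge0$. Let $P_0=1$, $P_{M}(x)=\det(xI_{M}-T^{[M-1]})$ for $M\ge1$; $\alpha_0=\beta_0=1$, $\alpha_N=(-1)^{(p-1)N}T_{p,0}\cdots T_{N+p-1,N-1}$, $\beta_N=(-1)^{(q-1)N}T_{0,q}\cdots T_{N-1,N+q-1}$ for $N\ge1$. For $n\ge0$, $Q_{n,N}$ is the $p\times p$ determinant with rows $(A^{(1)}_l,\dots,A^{(p)}_l)$, $l=n,N+1,\dots,N+p-1$ (in this order), and $R_{n,N}$ is the $q\times q$ determinant with rows $(B^{(1)}_l,\dots,B^{(q)}_l)$, $l=n,N+1,\dots,N+q-1$. Put $u^{\langle N\rangle}_{k,n}=\beta_N R_{n,N}(\lambda_k^{[N]})$, $w^{\langle N\rangle}_{k,n}=\dfrac{\alpha_N Q_{n,N}(\lambda_k^{[N]})}{P_N(\lambda_k^{[N]})P_{N+1}'(\lambda_k^{[N]})}$ ($n\ge0$, $0\le k\le N$): for $0\le n\le N$ these are the entries of right, resp. left, eigenvectors of $T^{[N]}$ for $\lambda_k^{[N]}$, biorthonormal: $\sum_{n=0}^N w^{\langle N\rangle}_{k,n}u^{\langle N\rangle}_{l,n}=\delta_{k,l}$ (known). The Christoffel numbers are $(\mu_{k,1}^{[N]},\dots,\mu_{k,p}^{[N]})^\top=\nu^{-1}(w_{k,0}^{\langle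 N\rangle},\dots,w_{k,p-1}^{\langle N\rangle})^\top$, $(\rho_{k,1}^{[N]},\dots,\rho_{k,q}^{[N]})^\top=\xi^{-1}(u_{k,0}^{\langle N\rangle},\dots,u_{k,q-1}^{\langle N\rangle})^\top$; one has $w_{k,n}^{\langle N\rangle}=\sum_a A_n^{(a)}(\lambda_k^{[N]})\mu_{k,a}^{[N]}$, $u_{k,n}^{\langle N\rangle}=\sum_b B_n^{(b)}(\lambda_k^{[N]})\rho_{k,b}^{[N]}$. The discrete measures are $\mathrm d\psi^{[N]}_{b,a}=\sum_{k=0}^N\rho^{[N]}_{k,b}\mu^{[N]}_{k,a}\,\delta_{\lambda_k^{[N]}}$. Appropriate choice of initial conditions: $\nu,\xi$ are chosen so that all Christoffel numbers $\rho^{[N]}_{k,b}$, $\mu^{[N]}_{k,a}$ ($0\le k\le N$) are positive for all sufficiently large $N$; when $T$ has a positive bidiagonal factorization such a choice exists (known). The total masses of $\mathrm d\psi^{[N]}_{b,a}$ are then uniformly bounded in $N$ (for large $N$ they equal $(\xi^{-1}I_{q,p}\nu^{-\top})_{b,a}$, $I_{q,p}$ being the rectangular identity), and $\mathrm d\psi_{b,a}$ denotes the weak limit, as $N\to\infty$ (along a subsequence), of $\mathrm d\psi^{[N]}_{b,a}$: a finite positive Borel measure on $[0,1]$. *)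

theory Defs
  imports
    "HOL-Probability.Probability"
    "Jordan_Normal_Form.Char_Poly"
    "Jordan_Normal_Form.Gauss_Jordan_Elimination"
begin

unbundle no vec_syntax
hide_const (open) Finite_Cartesian_Product.vec Determinants.det Finite_Cartesian_Product.mat

section \<open>Semi-infinite matrices\<close>

type_synonym smat = "nat \<Rightarrow> nat \<Rightarrow> real"

text \<open>
  Only products whose left factor has finitely many nonzero entries in every row are formed,
  so the series below is a finite sum.
\<close>

definition smat_mult :: "smat \<Rightarrow> smat \<Rightarrow> smat" where
  "smat_mult S T = (\<lambda>n m. \<Sum>l. S n l * T l m)"

definition smat_one :: smat where
  "smat_one = (\<lambda>n m. if n = m then 1 else 0)"

primrec smat_pow :: "smat \<Rightarrow> nat \<Rightarrow> smat" where
  "smat_pow T 0 = smat_one"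
| "smat_pow T (Suc k) = smat_mult T (smat_pow T k)"

definition stochastic :: "smat \<Rightarrow> bool" where
  "stochastic T \<longleftrightarrow> (\<forall>n m. 0 \<le> T n m) \<and> (\<forall>n. (\<lambda>m. T n m) sums 1)"

text \<open>
  \<open>p\<close> subdiagonals and \<open>q\<close> superdiagonals; \<open>n - p \<le> m\<close> is written \<open>n \<le> m + p\<close> to avoid
  truncated subtraction.
\<close>

definition positive_banded :: "nat \<Rightarrow> nat \<Rightarrow> smat \<Rightarrow> bool" where
  "positive_banded p q T \<longleftrightarrow>
     (\<forall>n m. if n \<le> m + p \<and> m \<le> n + q then 0 < T n m else T n m = 0)"

definition lower_bidiagonal :: "smat \<Rightarrow> bool" where
  "lower_bidiagonal L \<longleftrightarrow>
     (\<forall>n m. if n = m \<or> n = Suc m then 0 < L n m else L n m = 0)"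

definition upper_bidiagonal :: "smat \<Rightarrow> bool" where
  "upper_bidiagonal U \<longleftrightarrow>
     (\<forall>n m. if m = n \<or> m = Suc n then 0 < U n m else U n m = 0)"

definition positive_bidiagonal_factorization :: "nat \<Rightarrow> nat \<Rightarrow> smat \<Rightarrow> bool" where
  "positive_bidiagonal_factorization p q T \<longleftrightarrow>
     (\<exists>L U. (\<forall>i\<in>{1..p}. lower_bidiagonal (L i)) \<and>
            (\<forall>j\<in>{1..q}. upper_bidiagonal (U j)) \<and>
            T = foldr smat_mult (map L [1..<Suc p] @ map U (rev [1..<Suc q])) smat_one)"

section \<open>Truncations and their eigenvalues\<close>

text \<open>
  \<open>leading T M\<close> is the leading \<open>M \<times> M\<close> block, that is \<open>T\<^sup>[\<^sup>M\<^sup>-\<^sup>1\<^sup>]\<close>; thus \<open>T\<^sup>[\<^sup>N\<^sup>]\<close> is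
  \<open>leading T (Suc N)\<close>, and \<open>P\<^sub>M\<close> is the characteristic polynomial of \<open>leading T M\<close>.
\<close>

definition leading :: "smat \<Rightarrow> nat \<Rightarrow> real mat" where
  "leading T M = mat M M (\<lambda>(i, j). T i j)"

definition P_poly :: "smat \<Rightarrow> nat \<Rightarrow> real poly" where
  "P_poly T M = char_poly (leading T M)"

text \<open>The eigenvalues of \<open>T\<^sup>[\<^sup>N\<^sup>]\<close> in decreasing order, \<open>k = 0, \<dots>, N\<close>.\<close>

definition lam :: "smat \<Rightarrow> nat \<Rightarrow> nat \<Rightarrow> real" where
  "lam T N k = rev (sorted_list_of_set {x. eigenvalue (leading T (Suc N)) x}) ! k"

section \<open>Recursion polynomials\<close>

definition lower_unitriangular :: "nat \<Rightarrow> real mat \<Rightarrow> bool" where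
  "lower_unitriangular d V \<longleftrightarrow> V \<in> carrier_mat d d \<and>
     (\<forall>i<d. V $$ (i, i) = 1) \<and> (\<forall>i<d. \<forall>j<d. i < j \<longrightarrow> V $$ (i, j) = 0)"

text \<open>
  The superscripts \<open>a\<close> and \<open>b\<close> are counted from \<open>0\<close>: \<open>A a n\<close> stands for \<open>A\<^sub>n\<close> with superscript
  \<open>a + 1\<close>, and likewise for \<open>B\<close>, the Christoffel numbers and the measures. By bandedness,
  column \<open>n\<close> of \<open>T\<close> vanishes below row \<open>n + p\<close> and row \<open>n\<close> vanishes beyond column \<open>n + q\<close>,
  so the sums below are the full sums over \<open>l \<ge> 0\<close>.
\<close>

definition left_recursion_polys ::
    "nat \<Rightarrow> smat \<Rightarrow> real mat \<Rightarrow> (nat \<Rightarrow> nat \<Rightarrow> real poly) \<Rightarrow> bool" where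
  "left_recursion_polys p T \<nu> A \<longleftrightarrow> (\<forall>a<p.
     (\<forall>n<p. A a n = [:\<nu> $$ (n, a):]) \<and>
     (\<forall>n. (\<Sum>l\<le>n + p. Polynomial.smult (T l n) (A a l)) = [:0, 1:] * A a n))"

definition right_recursion_polys ::
    "nat \<Rightarrow> smat \<Rightarrow> real mat \<Rightarrow> (nat \<Rightarrow> nat \<Rightarrow> real poly) \<Rightarrow> bool" where
  "right_recursion_polys q T \<xi> B \<longleftrightarrow> (\<forall>b<q.
     (\<forall>n<q. B b n = [:\<xi> $$ (n, b):]) \<and>
     (\<forall>n. (\<Sum>l\<le>n + q. Polynomial.smult (T n l) (B b l)) = [:0, 1:] * B b n))"

section \<open>Christoffel numbers and discrete measures\<close>

text \<open>
  The \<open>d \<times> d\<close> determinant with rows \<open>l = n, N + 1, \<dots>, N + d - 1\<close>: it is \<open>Q\<close> for the left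
  polynomials (\<open>d = p\<close>) and \<open>R\<close> for the right ones (\<open>d = q\<close>).
\<close>

definition det_poly :: "nat \<Rightarrow> (nat \<Rightarrow> nat \<Rightarrow> real poly) \<Rightarrow> nat \<Rightarrow> nat \<Rightarrow> real poly" where
  "det_poly d C n N = det (mat d d (\<lambda>(i, c). C c (if i = 0 then n else N + i)))"

definition alpha :: "nat \<Rightarrow> smat \<Rightarrow> nat \<Rightarrow> real" where
  "alpha p T N = (- 1) ^ ((p - 1) * N) * (\<Prod>i<N. T (p + i) i)"

definition beta :: "nat \<Rightarrow> smat \<Rightarrow> nat \<Rightarrow> real" where
  "beta q T N = (- 1) ^ ((q - 1) * N) * (\<Prod>i<N. T i (q + i))"

definition u_vec :: "nat \<Rightarrow> smat \<Rightarrow> (nat \<Rightarrow> nat \<Rightarrow> real poly) \<Rightarrow> nat \<Rightarrow> nat \<Rightarrow> nat \<Rightarrow> real" where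
  "u_vec q T B N k n = beta q T N * poly (det_poly q B n N) (lam T N k)"

definition w_vec :: "nat \<Rightarrow> smat \<Rightarrow> (nat \<Rightarrow> nat \<Rightarrow> real poly) \<Rightarrow> nat \<Rightarrow> nat \<Rightarrow> nat \<Rightarrow> real" where
  "w_vec p T A N k n = alpha p T N * poly (det_poly p A n N) (lam T N k) /
     (poly (P_poly T N) (lam T N k) * poly (pderiv (P_poly T (Suc N))) (lam T N k))"

text \<open>\<open>the (mat_inverse V)\<close> is the inverse matrix of a (unitriangular, hence invertible) \<open>V\<close>.\<close>

definition christoffel_mu ::
    "nat \<Rightarrow> smat \<Rightarrow> real mat \<Rightarrow> (nat \<Rightarrow> nat \<Rightarrow> real poly) \<Rightarrow> nat \<Rightarrow> nat \<Rightarrow> nat \<Rightarrow> real" where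
  "christoffel_mu p T \<nu> A N k a = (the (mat_inverse \<nu>) *\<^sub>v vec p (w_vec p T A N k)) $ a"

definition christoffel_rho ::
    "nat \<Rightarrow> smat \<Rightarrow> real mat \<Rightarrow> (nat \<Rightarrow> nat \<Rightarrow> real poly) \<Rightarrow> nat \<Rightarrow> nat \<Rightarrow> nat \<Rightarrow> real" where
  "christoffel_rho q T \<xi> B N k b = (the (mat_inverse \<xi>) *\<^sub>v vec q (u_vec q T B N k)) $ b"

text \<open>Initial conditions for which all Christoffel numbers are positive for large \<open>N\<close>.\<close>

definition appropriate_initial_conditions ::
    "nat \<Rightarrow> nat \<Rightarrow> smat \<Rightarrow> real mat \<Rightarrow> real mat \<Rightarrow>
     (nat \<Rightarrow> nat \<Rightarrow> real poly) \<Rightarrow> (nat \<Rightarrow> nat \<Rightarrow> real poly) \<Rightarrow> bool" where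
  "appropriate_initial_conditions p q T \<nu> \<xi> A B \<longleftrightarrow>
     (\<forall>\<^sub>F N in sequentially. \<forall>k\<le>N.
        (\<forall>b<q. 0 < christoffel_rho q T \<xi> B N k b) \<and>
        (\<forall>a<p. 0 < christoffel_mu p T \<nu> A N k a))"

text \<open>
  The sum of the point masses \<open>\<rho> \<mu>\<close> at the eigenvalues, as a Borel measure on the reals.
  \<open>ennreal\<close> replaces negative weights by \<open>0\<close>; under appropriate initial conditions this
  affects only finitely many \<open>N\<close>.
\<close>

definition discrete_measure ::
    "nat \<Rightarrow> nat \<Rightarrow> smat \<Rightarrow> real mat \<Rightarrow> real mat \<Rightarrow>
     (nat \<Rightarrow> nat \<Rightarrow> real poly) \<Rightarrow> (nat \<Rightarrow> nat \<Rightarrow> real poly) \<Rightarrow>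
     nat \<Rightarrow> nat \<Rightarrow> nat \<Rightarrow> real measure" where
  "discrete_measure p q T \<nu> \<xi> A B N b a =
     distr (point_measure {..N}
              (\<lambda>k. ennreal (christoffel_rho q T \<xi> B N k b * christoffel_mu p T \<nu> A N k a)))
           borel (lam T N)"

section \<open>Weak limits\<close>

text \<open>
  Weak convergence of finite Borel measures on the line, by bounded continuous test functions;
  the library's \<open>weak_conv_m\<close> (pointwise convergence of distribution functions) is tailored to
  probability measures, whereas the total masses here need not be \<open>1\<close>.
\<close>

definition weak_limit :: "(nat \<Rightarrow> real measure) \<Rightarrow> real measure \<Rightarrow> bool" where
  "weak_limit M\<^sub>s M \<longleftrightarrow> (\<forall>f :: real \<Rightarrow> real. continuous_on UNIV f \<longrightarrow> bounded (range f) \<longrightarrow>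
     (\<lambda>j. \<integral>x. f x \<partial>M\<^sub>s j) \<longlonglongrightarrow> (\<integral>x. f x \<partial>M))"

definition finite_borel_measure_on_unit_interval :: "real measure \<Rightarrow> bool" where
  "finite_borel_measure_on_unit_interval M \<longleftrightarrow>
     finite_measure M \<and> sets M = sets borel \<and> emeasure M (- {0..1}) = 0"

text \<open>A single subsequence serves all entries of the matrix of measures.\<close>

definition spectral_measures ::
    "nat \<Rightarrow> nat \<Rightarrow> smat \<Rightarrow> real mat \<Rightarrow> real mat \<Rightarrow>
     (nat \<Rightarrow> nat \<Rightarrow> real poly) \<Rightarrow> (nat \<Rightarrow> nat \<Rightarrow> real poly) \<Rightarrow>
     (nat \<Rightarrow> nat \<Rightarrow> real measure) \<Rightarrow> bool" where
  "spectral_measures p q T \<nu> \<xi> A B \<psi> \<longleftrightarrow>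
     (\<forall>b<q. \<forall>a<p. finite_borel_measure_on_unit_interval (\<psi> b a)) \<and>
     (\<exists>\<phi>. strict_mono \<phi> \<and>
       (\<forall>b<q. \<forall>a<p. weak_limit (\<lambda>j. discrete_measure p q T \<nu> \<xi> A B (\<phi> j) b a) (\<psi> b a)))"

section \<open>Markov chains and generating functions\<close>

definition markov_chain :: "smat \<Rightarrow> 'w measure \<Rightarrow> (nat \<Rightarrow> 'w \<Rightarrow> nat) \<Rightarrow> bool" where
  "markov_chain T M X \<longleftrightarrow> prob_space M \<and>
     (\<forall>r. X r \<in> measurable M (count_space UNIV)) \<and>
     (\<forall>r i j. \<P>(\<omega> in M. \<forall>t\<le>r. X t \<omega> = i t) > 0 \<longrightarrow>
        \<P>(\<omega> in M. X (Suc r) \<omega> = j \<bar> \<forall>t\<le>r. X t \<omega> = i t) = T (i r) j)"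

definition first_passage_prob ::
    "'w measure \<Rightarrow> (nat \<Rightarrow> 'w \<Rightarrow> nat) \<Rightarrow> nat \<Rightarrow> nat \<Rightarrow> nat \<Rightarrow> real" where
  "first_passage_prob M X r n m =
     \<P>(\<omega> in M. X r \<omega> = m \<and> (\<forall>t\<in>{1..<r}. X t \<omega> \<noteq> m) \<bar> X 0 \<omega> = n)"

definition transition_gf :: "smat \<Rightarrow> complex \<Rightarrow> nat \<Rightarrow> nat \<Rightarrow> complex" where
  "transition_gf T s n m = (\<Sum>r. of_real (smat_pow T r n m) * s ^ r)"

text \<open>The sum starts at \<open>r = 1\<close>.\<close>

definition first_passage_gf ::
    "'w measure \<Rightarrow> (nat \<Rightarrow> 'w \<Rightarrow> nat) \<Rightarrow> complex \<Rightarrow> nat \<Rightarrow> nat \<Rightarrow> complex" where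
  "first_passage_gf M X s n m =
     (\<Sum>r. of_real (first_passage_prob M X (Suc r) n m) * s ^ Suc r)"

definition stieltjes_sum ::
    "nat \<Rightarrow> nat \<Rightarrow> (nat \<Rightarrow> nat \<Rightarrow> real poly) \<Rightarrow> (nat \<Rightarrow> nat \<Rightarrow> real poly) \<Rightarrow>
     (nat \<Rightarrow> nat \<Rightarrow> real measure) \<Rightarrow> complex \<Rightarrow> nat \<Rightarrow> nat \<Rightarrow> complex" where
  "stieltjes_sum p q A B \<psi> s n m =
     (\<Sum>a<p. \<Sum>b<q. LINT x:{0..1}|\<psi> b a.
        of_real (poly (B b n) x) * (1 / (1 - s * of_real x)) * of_real (poly (A a m) x))"

end

theory Submission
  imports Defs
begin

text \<open>
  The spectrum of a truncation \<open>T\<^sup>[\<^sup>N\<^sup>]\<close> is real because \<open>T\<^sup>[\<^sup>N\<^sup>]\<close>, a product of nonnegative bidiagonal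
  matrices, diminishes sign changes: along the orbit of a vector the possible sign patterns stabilise,
  which is incompatible with the rotation caused by a nonreal eigenvalue. It is simple because a
  multiple eigenvalue would have vanishing Christoffel numbers.

  A block determinant gives \<open>P\<^sub>M = \<beta>\<^sub>M R\<^sub>M\<^sub>,\<^sub>M\<close>. Hence \<open>u\<^sub>n(x) = \<beta>\<^sub>N R\<^sub>n\<^sub>,\<^sub>N(x)\<close> satisfies
  \<open>(x - T\<^sup>[\<^sup>N\<^sup>]) u(x) = P\<^sub>N\<^sub>+\<^sub>1(x) e\<^sub>N\<close>; pairing this identity and its derivative with a left eigenvector
  yields biorthonormality, so the discrete measures reproduce \<open>(T\<^sup>k)\<^sub>n\<^sub>,\<^sub>m\<close> exactly once \<open>N\<close> is large.
  Weak convergence carries the formula over to \<open>\<psi>\<close>, the geometric series sums it, and the renewal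
  equation gives the first passage functions.
\<close>

section \<open>Variation diminishing matrices have real spectrum\<close>

text \<open>The indices \<open>f 0 < f 1 < ...\<close> select \<open>k\<close> nonzero entries of
  strictly alternating sign, the first with the sign of \<open>\<sigma>\<close>; they witness
  \<open>k - 1\<close> sign changes. Every vector admits \<open>k = 0\<close>.\<close>

definition alternates :: "nat \<Rightarrow> (nat \<Rightarrow> real) \<Rightarrow> nat \<Rightarrow> real \<Rightarrow> bool" where
  "alternates n v k \<sigma> \<longleftrightarrow>
     (\<exists>f. strict_mono_on {..<k} f \<and> (\<forall>j<k. f j < n \<and> \<sigma> * (- 1) ^ j * v (f j) > 0))"

lemma alternates_cong:
  assumes "\<And>i. i < n \<Longrightarrow> v i = w i"
  shows "alternates n v k \<sigma> = alternates n w k \<sigma>"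
  using assms unfolding alternates_def by metis

lemma alternates_le:
  assumes "alternates n v k \<sigma>"
  shows "k \<le> n"
proof -
  obtain f where f: "strict_mono_on {..<k} f" "\<forall>j<k. f j < n"
    using assms unfolding alternates_def by blast
  have "inj_on f {..<k}" using f(1) by (rule strict_mono_on_imp_inj_on)
  moreover have "f ` {..<k} \<subseteq> {..<n}" using f(2) by auto
  ultimately have "card {..<k} \<le> card {..<n}" by (intro card_inj_on_le) auto
  then show ?thesis by simp
qed

text \<open>The first nonzero entry, if its sign is opposite to \<open>\<tau>\<close>, can be put in
  front of the alternation. Thus an alternation of maximal length dictates the sign of the first
  nonzero entry.\<close>

lemma alternates_Suc:
  assumes "alternates n v k \<tau>" and "i < n" and "\<And>j. j < i \<Longrightarrow> v j = 0" and "\<tau> * v i < 0"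
  shows "alternates n v (Suc k) (- \<tau>)"
proof -
  obtain f where f: "strict_mono_on {..<k} f" "\<And>j. j < k \<Longrightarrow> f j < n"
      "\<And>j. j < k \<Longrightarrow> \<tau> * (- 1) ^ j * v (f j) > 0"
    using assms(1) unfolding alternates_def by blast
  define g where "g = case_nat i f"
  have i: "i < f j" if "j < k" for j
  proof -
    have "i < f 0" if "0 < k"
    proof (rule ccontr)
      assume "\<not> i < f 0"
      moreover have "v (f 0) \<noteq> 0" using f(3)[of 0] that by auto
      ultimately have "f 0 = i" using assms(3)[of "f 0"] by force
      then show False using f(3)[of 0] that assms(4) by simp
    qed
    moreover have "f 0 \<le> f j"
      using f(1) that by (cases "j = 0") (auto simp: strict_mono_on_def less_imp_le)
    ultimately show ?thesis using that by (metis gr_zeroI less_le_trans less_nat_zero_code)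
  qed
  have "strict_mono_on {..<Suc k} g"
    using f(1) i by (auto simp: strict_mono_on_def g_def split: nat.split)
  moreover have "g j < n \<and> - \<tau> * (- 1) ^ j * v (g j) > 0" if "j < Suc k" for j
    using f(2,3)[of "j - 1"] assms(2,4) that by (cases j) (auto simp: g_def)
  ultimately show ?thesis unfolding alternates_def by blast
qed

section \<open>Variation diminution of products of bidiagonal matrices\<close>

definition act :: "nat \<Rightarrow> smat \<Rightarrow> (nat \<Rightarrow> real) \<Rightarrow> nat \<Rightarrow> real" where
  "act n S v i = (\<Sum>j<n. S i j * v j)"

text \<open>The leading sign \<open>\<sigma>\<close> is preserved along with the length, which is
  more than a bound on the number of sign changes; the orbit argument below depends on it.\<close>

definition variation_diminishing :: "nat \<Rightarrow> smat \<Rightarrow> bool" where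
  "variation_diminishing n S \<longleftrightarrow>
     (\<forall>v k \<sigma>. alternates n (act n S v) k \<sigma> \<longrightarrow> alternates n v k \<sigma>)"


text \<open>Each alternating entry of \<open>S v\<close> comes from an entry of \<open>v\<close> of the same sign in the support of
  that row; the staircase shape orders the new indices weakly, and strictly since consecutive signs
  differ.\<close>

lemma staircase_variation_diminishing:
  assumes nonneg: "\<And>i l. 0 \<le> S i l"
    and staircase: "\<And>i i' l l'. S i l \<noteq> 0 \<Longrightarrow> S i' l' \<noteq> 0 \<Longrightarrow> i < i' \<Longrightarrow> l \<le> l'"
  shows "variation_diminishing n S"
  unfolding variation_diminishing_def
proof (intro allI impI)
  fix v k \<sigma>
  assume "alternates n (act n S v) k \<sigma>"
  then obtain f where f: "strict_mono_on {..<k} f"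
      "\<And>j. j < k \<Longrightarrow> \<sigma> * (- 1) ^ j * act n S v (f j) > 0"
    unfolding alternates_def by blast
  have ex: "\<exists>l<n. S (f j) l \<noteq> 0 \<and> \<sigma> * (- 1) ^ j * v l > 0" if j: "j < k" for j
  proof (rule ccontr)
    assume neg: "\<not> ?thesis"
    have "\<sigma> * (- 1) ^ j * (S (f j) l * v l) \<le> 0" if l: "l < n" for l
    proof (cases "S (f j) l = 0")
      case False
      then have "\<sigma> * (- 1) ^ j * v l \<le> 0" using neg l by (meson not_less)
      then have "S (f j) l * (\<sigma> * (- 1) ^ j * v l) \<le> 0"
        by (rule mult_nonneg_nonpos[OF nonneg])
      then show ?thesis by (simp add: mult_ac)
    qed simp
    then have "\<sigma> * (- 1) ^ j * act n S v (f j) \<le> 0"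
      unfolding act_def sum_distrib_left by (intro sum_nonpos) auto
    then show False using f(2)[OF j] by simp
  qed
  then obtain g where g: "\<And>j. j < k \<Longrightarrow> g j < n" "\<And>j. j < k \<Longrightarrow> S (f j) (g j) \<noteq> 0"
      "\<And>j. j < k \<Longrightarrow> \<sigma> * (- 1) ^ j * v (g j) > 0"
    by metis
  have weak: "g i \<le> g j" if "i < j" "j < k" for i j
    using staircase[of "f i" "g i" "f j" "g j"] g(2)[of i] g(2)[of j] f(1) that
    by (auto simp: strict_mono_on_def)
  have step: "g j < g (Suc j)" if "Suc j < k" for j
    using weak[of j "Suc j"] g(3)[of j] g(3)[of "Suc j"] that by (cases "g j = g (Suc j)") auto
  have "strict_mono_on {..<k} g"
    unfolding strict_mono_on_def
  proof (intro allI impI)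
    fix i j assume "i \<in> {..<k} \<and> j \<in> {..<k} \<and> i < j"
    then show "g i < g j"
      using step[of i] weak[of "Suc i" j] by (cases "Suc i = j") auto
  qed
  then show "alternates n v k \<sigma>" using g(1,3) unfolding alternates_def by blast
qed

lemma lower_bidiagonal_variation_diminishing:
  assumes "lower_bidiagonal S"
  shows "variation_diminishing n S"
proof (rule staircase_variation_diminishing)
  have S: "if i = l \<or> i = Suc l then 0 < S i l else S i l = 0" for i l
    using assms unfolding lower_bidiagonal_def by blast
  show "0 \<le> S i l" for i l using S[of i l] by (auto split: if_splits)
  show "l \<le> l'" if "S i l \<noteq> 0" "S i' l' \<noteq> 0" "i < i'" for i i' l l'
    using S[of i l] S[of i' l'] that by (auto split: if_splits)
qed

lemma upper_bidiagonal_variation_diminishing: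
  assumes "upper_bidiagonal S"
  shows "variation_diminishing n S"
proof (rule staircase_variation_diminishing)
  have S: "if i = l \<or> l = Suc i then 0 < S i l else S i l = 0" for i l
    using assms unfolding upper_bidiagonal_def by metis
  show "0 \<le> S i l" for i l using S[of i l] by (auto split: if_splits)
  show "l \<le> l'" if "S i l \<noteq> 0" "S i' l' \<noteq> 0" "i < i'" for i i' l l'
    using S[of i l] S[of i' l'] that by (auto split: if_splits)
qed

lemma variation_diminishing_compose:
  assumes "variation_diminishing n S" "variation_diminishing n R"
    and "\<And>v i. i < n \<Longrightarrow> act n Q v i = act n S (act n R v) i"
  shows "variation_diminishing n Q"
  using assms unfolding variation_diminishing_def by (metis alternates_cong)

lemma smat_mult_finite:
  assumes "finite I" and "\<And>l. l \<notin> I \<Longrightarrow> S i l = 0 \<or> R l j = 0"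
  shows "smat_mult S R i j = (\<Sum>l\<in>I. S i l * R l j)"
  unfolding smat_mult_def by (rule suminf_finite) (use assms in auto)

text \<open>Truncation to \<open>n\<close> respects a product when no term
  \<open>S i l * R l j\<close> with \<open>j < n\<close> passes through an index
  \<open>l \<ge> n\<close>.\<close>

lemma act_smat_mult:
  assumes "\<And>j l. j < n \<Longrightarrow> l \<ge> n \<Longrightarrow> S i l = 0 \<or> R l j = 0"
  shows "act n (smat_mult S R) v i = act n S (act n R v) i"
proof -
  have "smat_mult S R i j = (\<Sum>l<n. S i l * R l j)" if "j < n" for j
    by (rule smat_mult_finite) (use assms that in auto)
  then show ?thesis
    unfolding act_def sum_distrib_left
    by (subst sum.swap) (simp add: sum_distrib_left sum_distrib_right mult_ac)
qed

lemma variation_diminishing_one: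
  "variation_diminishing n smat_one"
  by (rule staircase_variation_diminishing) (auto simp: smat_one_def split: if_splits)

text \<open>Upper triangularity is carried through the induction because it is what lets the next
  factor be truncated by \<open>act_smat_mult\<close>.\<close>

lemma variation_diminishing_upper_product:
  assumes "\<And>U. U \<in> set Us \<Longrightarrow> upper_bidiagonal U"
  shows "variation_diminishing n (foldr smat_mult Us smat_one)
    \<and> (\<forall>l j. j < l \<longrightarrow> foldr smat_mult Us smat_one l j = 0)"
  using assms
proof (induction Us)
  case Nil
  then show ?case by (simp add: variation_diminishing_one) (simp add: smat_one_def)
next
  case (Cons U Us)
  let ?R = "foldr smat_mult Us smat_one"
  have R: "variation_diminishing n ?R" "\<And>l j. j < l \<Longrightarrow> ?R l j = 0" using Cons by auto
  have U: "upper_bidiagonal U" using Cons.prems by simp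
  have "smat_mult U ?R l j = 0" if "j < l" for l j
  proof -
    have "U l i = 0 \<or> ?R i j = 0" for i
      using U R(2)[of j i] that unfolding upper_bidiagonal_def by (cases "j < i") auto
    then show ?thesis by (subst smat_mult_finite[of "{}"]) auto
  qed
  moreover have "variation_diminishing n (smat_mult U ?R)"
    using upper_bidiagonal_variation_diminishing[OF U] R(1)
    by (rule variation_diminishing_compose) (use R(2) in \<open>auto intro!: act_smat_mult\<close>)
  ultimately show ?case by simp
qed

text \<open>A row \<open>i < n\<close> of a lower bidiagonal factor ends before column
  \<open>n\<close>, so \<open>act_smat_mult\<close> applies whatever stands to its right.\<close>

lemma variation_diminishing_lower_product:
  assumes "\<And>L. L \<in> set Ls \<Longrightarrow> lower_bidiagonal L" and "variation_diminishing n R"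
  shows "variation_diminishing n (foldr smat_mult Ls R)"
  using assms(1)
proof (induction Ls)
  case (Cons L Ls)
  have L: "lower_bidiagonal L" using Cons.prems by simp
  have "variation_diminishing n (smat_mult L (foldr smat_mult Ls R))"
  proof (rule variation_diminishing_compose)
    show "variation_diminishing n L" using L by (rule lower_bidiagonal_variation_diminishing)
    show "act n (smat_mult L (foldr smat_mult Ls R)) v i = act n L (act n (foldr smat_mult Ls R) v) i"
      if "i < n" for v i
      using L that unfolding lower_bidiagonal_def
      by (intro act_smat_mult) auto
  qed (use Cons in auto)
  then show ?case by simp
qed (use assms in simp)

lemma positive_bidiagonal_factorization_variation_diminishing:
  assumes "positive_bidiagonal_factorization p q T"
  shows "variation_diminishing n T"
proof -
  obtain L U where LU: "\<forall>i\<in>{1..p}. lower_bidiagonal (L i)" "\<forall>j\<in>{1..q}. upper_bidiagonal (U j)"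
    "T = foldr smat_mult (map L [1..<Suc p] @ map U (rev [1..<Suc q])) smat_one"
    using assms unfolding positive_bidiagonal_factorization_def by blast
  have "variation_diminishing n (foldr smat_mult (map U (rev [1..<Suc q])) smat_one)"
    by (rule variation_diminishing_upper_product[THEN conjunct1]) (use LU(2) in auto)
  then have "variation_diminishing n (foldr smat_mult (map L [1..<Suc p])
      (foldr smat_mult (map U (rev [1..<Suc q])) smat_one))"
    by (rule variation_diminishing_lower_product[rotated]) (use LU(1) in auto)
  then show ?thesis unfolding LU(3) foldr_append .
qed

text \<open>A positive sequence would have decreasing ratios \<open>y (m + 1) / y m\<close> with decrements bounded
  below, because \<open>t\<^sup>2 - 2 a t + b\<close> has no real root.\<close>

lemma nonneg_oscillating_recurrence_zero:
  fixes y :: "nat \<Rightarrow> real"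
  assumes nonneg: "\<And>m. 0 \<le> y m"
    and rec: "\<And>m. y (m + 2) = 2 * a * y (m + 1) - b * y m" and disc: "a\<^sup>2 < b"
  shows "y m = 0"
proof (rule ccontr)
  assume "y m \<noteq> 0"
  then have y0: "y m > 0" using nonneg[of m] by simp
  have b: "b > 0" using disc by (meson le_less_trans zero_le_power2)
  \<comment> \<open>A zero following a positive term would make the next term \<open>- b\<close>
    times that positive term.\<close>
  have pos: "y (m + i) > 0" for i
  proof (induction i)
    case (Suc i)
    have "y (m + i + 1) \<noteq> 0"
    proof
      assume "y (m + i + 1) = 0"
      then have "y (m + i + 2) < 0" using rec[of "m + i"] Suc b by simp
      then show False using nonneg[of "m + i + 2"] by simp
    qed
    then show ?case using nonneg[of "m + i + 1"] by simp
  qed (use y0 in simp)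
  define r where "r i = y (m + i + 1) / y (m + i)" for i
  have r: "r i > 0" for i using pos[of i] pos[of "i + 1"] by (simp add: r_def)
  have step: "r (Suc i) = 2 * a - b / r i" for i
    using rec[of "m + i"] pos[of i] pos[of "i + 1"] by (simp add: r_def field_simps)
  \<comment> \<open>Completing the square in \<open>t\<^sup>2 - 2 a t + b\<close>.\<close>
  have dec: "r i - r (Suc i) = ((r i - a)\<^sup>2 + (b - a\<^sup>2)) / r i" for i
    using r[of i] by (simp add: step field_simps power2_eq_square)
  have anti: "r i \<le> r 0" for i
  proof (induction i)
    case (Suc i)
    have "0 \<le> ((r i - a)\<^sup>2 + (b - a\<^sup>2)) / r i" using r[of i] disc by simp
    then show ?case using Suc dec[of i] by simp
  qed simp
  define c where "c = (b - a\<^sup>2) / r 0"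
  have c: "c > 0" using disc r[of 0] by (simp add: c_def)
  have "c \<le> r i - r (Suc i)" for i
    unfolding c_def dec using r[of i] anti[of i] disc by (intro frac_le) auto
  then have dec_c: "r (Suc i) \<le> r i - c" for i by (simp add: algebra_simps)
  have bound: "r i \<le> r 0 - real i * c" for i
  proof (induction i)
    case (Suc i)
    then show ?case using dec_c[of i] by (simp add: algebra_simps)
  qed simp
  obtain i where "r 0 < real i * c" using c reals_Archimedean3 by blast
  then show False using bound[of i] r[of i] by simp
qed
text \<open>Along the orbit \<open>Re (\<mu>\<^sup>m z)\<close> of a real matrix the sets of alternation types decrease, hence
  stabilise; a maximal type then fixes the sign of the first nonzero entry, so by induction on \<open>i\<close>
  the entry \<open>i\<close> is eventually an oscillating sequence of constant sign.\<close>

lemma variation_diminishing_eigenvalue_real: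
  fixes S :: smat and z :: "nat \<Rightarrow> complex" and \<mu> :: complex
  assumes vd: "variation_diminishing n S"
    and eig: "\<And>i. i < n \<Longrightarrow> (\<Sum>j<n. of_real (S i j) * z j) = \<mu> * z i"
    and z: "i0 < n" "z i0 \<noteq> 0"
  shows "\<mu> \<in> \<real>"
proof (rule ccontr)
  assume "\<mu> \<notin> \<real>"
  then have im: "Im \<mu> \<noteq> 0" by (simp add: complex_is_Real_iff)
  define v where "v m i = Re (\<mu> ^ m * z i)" for m i
  have step: "act n S (v m) i = v (Suc m) i" if "i < n" for m i
  proof -
    have "act n S (v m) i = Re (\<mu> ^ m * (\<Sum>j<n. of_real (S i j) * z j))"
      by (simp add: act_def v_def sum_distrib_left mult.left_commute[of _ "complex_of_real _"])
    also have "\<dots> = v (Suc m) i" unfolding eig[OF that] v_def power_Suc by (simp only: mult_ac)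
    finally show ?thesis .
  qed
  have rec: "v (m + 2) i = 2 * Re \<mu> * v (m + 1) i - (cmod \<mu>)\<^sup>2 * v m i" for m i
  proof -
    \<comment> \<open>\<open>\<mu>\<close> is a root of its real quadratic polynomial, with trace
      \<open>2 Re \<mu>\<close> and determinant the squared modulus.\<close>
    have "\<mu>\<^sup>2 = of_real (2 * Re \<mu>) * \<mu> - of_real ((cmod \<mu>)\<^sup>2)"
      by (simp add: complex_eq_iff power2_eq_square cmod_def)
    then have "\<mu> ^ (m + 2) * z i =
        of_real (2 * Re \<mu>) * (\<mu> ^ (m + 1) * z i) - of_real ((cmod \<mu>)\<^sup>2) * (\<mu> ^ m * z i)"
      by (simp only: power_add power_one_right) (simp only: algebra_simps)
    then show ?thesis unfolding v_def by (simp del: of_real_mult of_real_power)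
  qed
  define E where "E m = {(k, \<sigma>). (\<sigma> = 1 \<or> \<sigma> = - 1) \<and> alternates n (v m) k \<sigma>}" for m
  have fin: "finite (E m)" for m
    by (rule finite_subset[of _ "{..n} \<times> {1, - 1}"]) (auto simp: E_def dest: alternates_le)
  have mono: "E (Suc m) \<subseteq> E m" for m
    using vd step unfolding E_def variation_diminishing_def
    by (auto simp: alternates_cong[of n "v (Suc m)" "act n S (v m)"])
  \<comment> \<open>At a time \<open>M\<close> of minimal cardinality the decreasing finite sets
    \<open>E m\<close> have become constant.\<close>
  obtain M where M: "\<And>m. card (E M) \<le> card (E m)"
    using ex_has_least_nat[of "\<lambda>_. True" 0 "\<lambda>m. card (E m)"] by blast
  have E: "E (M + m) = E M" for m
  proof (induction m)
    case (Suc m)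
    then show ?case using mono[of "M + m"] fin[of M] M[of "M + Suc m"]
      by (metis add_Suc_right card_seteq)
  qed simp
  have "(0, 1) \<in> E M" by (auto simp: E_def alternates_def)
  then have ne: "fst ` E M \<noteq> {}" by blast
  define k where "k = Max (fst ` E M)"
  have "k \<in> fst ` E M" unfolding k_def using fin ne by (intro Max_in) auto
  then obtain \<tau> where \<tau>: "(k, \<tau>) \<in> E M" by force
  have kmax: "(Suc k, \<sigma>) \<notin> E M" for \<sigma>
  proof
    assume "(Suc k, \<sigma>) \<in> E M"
    then have "Suc k \<le> k" unfolding k_def using fin by (intro Max_ge) force+
    then show False by simp
  qed
  have sign: "\<tau> * v (M + m) i \<ge> 0" if "i < n" "\<And>j. j < i \<Longrightarrow> v (M + m) j = 0" for m i
  proof (rule ccontr)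
    assume "\<not> ?thesis"
    moreover have "alternates n (v (M + m)) k \<tau>"
      using \<tau> unfolding E[of m, symmetric] by (simp add: E_def)
    ultimately have "alternates n (v (M + m)) (Suc k) (- \<tau>)"
      using that by (intro alternates_Suc[of _ _ _ _ i]) auto
    then have "(Suc k, - \<tau>) \<in> E M" using \<tau> unfolding E[of m, symmetric] by (auto simp: E_def)
    then show False using kmax by blast
  qed
  have disc: "(Re \<mu>)\<^sup>2 < (cmod \<mu>)\<^sup>2" using im by (simp add: cmod_power2)
  have "\<forall>m. v (M + m) i = 0" if "i < n" for i
    using that
  proof (induction i rule: less_induct)
    case (less i)
    have "\<tau> * v (M + m) i = 0" for m
    proof (rule nonneg_oscillating_recurrence_zero[where y = "\<lambda>m. \<tau> * v (M + m) i", OF _ _ disc])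
      show "0 \<le> \<tau> * v (M + m) i" for m using sign less by auto
      show "\<tau> * v (M + (m + 2)) i =
          2 * Re \<mu> * (\<tau> * v (M + (m + 1)) i) - (cmod \<mu>)\<^sup>2 * (\<tau> * v (M + m) i)" for m
        using arg_cong[OF rec[of "M + m" i], of "(*) \<tau>"] by (simp only: algebra_simps)
    qed
    then show ?case using \<tau> by (auto simp: E_def)
  qed
  then have "v M i0 = 0" "v (M + 1) i0 = 0" using z(1) by (metis add_0_right)+
  \<comment> \<open>The real part of \<open>\<mu> * \<zeta>\<close> is
    \<open>Re \<mu> * Re \<zeta> - Im \<mu> * Im \<zeta>\<close>, so vanishing real parts at two
    consecutive times also remove the imaginary part.\<close>
  then have "Re (\<mu> ^ M * z i0) = 0" "Im \<mu> * Im (\<mu> ^ M * z i0) = 0"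
    by (simp_all add: v_def mult.assoc)
  then have "\<mu> ^ M * z i0 = 0" using im by (auto simp: complex_eq_iff)
  then show False using z(2) im by auto
qed

section \<open>Roots of the characteristic polynomials of the truncations\<close>

lemma leading_carrier [simp]: "leading T n \<in> carrier_mat n n"
  by (simp add: leading_def)

lemma char_poly_leading_complex_root_real:
  assumes "variation_diminishing n T"
    and "poly (map_poly complex_of_real (char_poly (leading T n))) x = 0"
  shows "x \<in> \<real>"
proof -
  let ?A = "leading T n" and ?C = "map_mat complex_of_real (leading T n)"
  interpret of_real_hom: comm_ring_hom complex_of_real by unfold_locales auto
  have C: "?C \<in> carrier_mat n n" by simp
  have "eigenvalue ?C x"
    using assms(2) by (simp add: eigenvalue_root_char_poly[OF C]
      of_real_hom.char_poly_hom[of ?A n])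
  then obtain w where w: "w \<in> carrier_vec n" "w \<noteq> 0\<^sub>v n" "?C *\<^sub>v w = x \<cdot>\<^sub>v w"
    unfolding eigenvalue_def eigenvector_def by (auto simp: leading_def)
  obtain i0 where "i0 < n" "w $ i0 \<noteq> 0" using w(1,2) by (metis carrier_vecD eq_vecI index_zero_vec)
  moreover have "(\<Sum>j<n. of_real (T i j) * w $ j) = x * w $ i" if "i < n" for i
  proof -
    have "(?C *\<^sub>v w) $ i = x * w $ i" using w(1,3) that by simp
    then show ?thesis using that w(1)
      by (simp add: leading_def scalar_prod_def atLeast0LessThan)
  qed
  ultimately show ?thesis using assms(1) by (intro variation_diminishing_eigenvalue_real) auto
qed

text \<open>Over the complex numbers the polynomial splits. All its roots are real and simple, so it
  is squarefree there and has as many roots as its degree.\<close>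

lemma card_real_roots_eq_degree:
  fixes P :: "real poly"
  assumes real: "\<And>z. poly (map_poly complex_of_real P) z = 0 \<Longrightarrow> z \<in> \<real>"
    and simple: "\<And>x. poly P x = 0 \<Longrightarrow> poly (pderiv P) x \<noteq> 0"
  shows "card {x. poly P x = 0} = degree P"
proof -
  let ?C = "map_poly complex_of_real P"
  interpret of_real_hom: inj_comm_ring_hom complex_of_real by unfold_locales auto
  have dhom: "pderiv ?C = map_poly of_real (pderiv P)" by (simp add: of_real_hom.map_poly_pderiv)
  have rs: "rsquarefree ?C"
    unfolding rsquarefree_roots
  proof (intro allI notI)
    fix a assume a: "poly ?C a = 0 \<and> poly (pderiv ?C) a = 0"
    then obtain x where "a = of_real x" using real by (auto elim: Reals_cases)
    then show False using a simple[of x] by (simp add: dhom)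
  qed
  have "{z. poly ?C z = 0} = of_real ` {x. poly P x = 0}"
  proof (intro equalityI subsetI)
    fix z assume z: "z \<in> {z. poly ?C z = 0}"
    then obtain x where "z = of_real x" using real by (auto elim: Reals_cases)
    then show "z \<in> of_real ` {x. poly P x = 0}" using z by auto
  qed auto
  then have "card {z. poly ?C z = 0} = card {x. poly P x = 0}"
    by (simp add: card_image inj_on_def)
  moreover have "card {z. poly ?C z = 0} = degree ?C"
  proof -
    have "?C \<noteq> 0" using rs by (simp add: rsquarefree_def)
    have "degree ?C = degree (Polynomial.smult (lead_coeff ?C) (\<Prod>z|poly ?C z = 0. [:-z, 1:]))"
      using complex_poly_decompose_rsquarefree[OF rs] by simp
    also have "\<dots> = degree (\<Prod>z|poly ?C z = 0. [:-z, 1:])" using \<open>?C \<noteq> 0\<close> by simp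
    also have "\<dots> = card {z. poly ?C z = 0}" by (subst degree_prod_sum_eq) auto
    finally show ?thesis by simp
  qed
  ultimately show ?thesis by simp
qed

section \<open>Determinants of recursion polynomials\<close>

lemma det_four_block_lower_left_zero_mat:
  fixes f :: "nat \<times> nat \<Rightarrow> 'a :: idom"
  assumes zero: "\<And>i j. n \<le> i \<Longrightarrow> i < n + m \<Longrightarrow> j < n \<Longrightarrow> f (i, j) = 0"
  shows "det (mat (n + m) (n + m) f) =
    det (mat n n f) * det (mat m m (\<lambda>(i, j). f (n + i, n + j)))"
proof -
  have "mat (n + m) (n + m) f = four_block_mat (mat n n f) (mat n m (\<lambda>(i, j). f (i, n + j)))
      (0\<^sub>m m n) (mat m m (\<lambda>(i, j). f (n + i, n + j)))"
    by (rule eq_matI) (use zero in auto)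
  then show ?thesis
    using det_four_block_mat_lower_left_zero[of "mat n n f" n "mat n m (\<lambda>(i, j). f (i, n + j))" m
        "0\<^sub>m m n" "mat m m (\<lambda>(i, j). f (n + i, n + j))"] by simp
qed

lemma lower_unitriangular_inverse:
  assumes "lower_unitriangular d V"
  shows "the (mat_inverse V) * V = 1\<^sub>m d \<and> the (mat_inverse V) \<in> carrier_mat d d"
proof -
  have V: "V \<in> carrier_mat d d" using assms by (simp add: lower_unitriangular_def)
  have "det V = prod_list (diag_mat V)"
    using assms V by (intro det_lower_triangular) (auto simp: lower_unitriangular_def)
  also have "\<dots> = 1"
    using assms V by (intro prod_list_neutral) (auto simp: lower_unitriangular_def diag_mat_def)
  finally have "V \<in> Units (ring_mat TYPE(real) d ())" using V by (intro det_non_zero_imp_unit) auto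
  then obtain W where "mat_inverse V = Some W" using mat_inverse(1)[OF V] by fastforce
  then show ?thesis using mat_inverse(2)[OF V] by simp
qed

text \<open>An invertible \<open>V\<close> determines the coefficients from the first
  \<open>d\<close> values. This identifies the Christoffel numbers with the coefficients of a
  determinant expansion.\<close>

lemma christoffel_coefficients:
  assumes V: "lower_unitriangular d V" and c: "c < d"
    and f: "\<And>n. n < d \<Longrightarrow> f n = (\<Sum>c<d. V $$ (n, c) * \<kappa> c)"
  shows "(the (mat_inverse V) *\<^sub>v vec d f) $ c = \<kappa> c"
proof -
  have carr: "V \<in> carrier_mat d d" using V by (simp add: lower_unitriangular_def)
  have "vec d f = V *\<^sub>v vec d \<kappa>"
    by (rule eq_vecI) (use carr f in \<open>auto simp: scalar_prod_def atLeast0LessThan\<close>)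
  then have "the (mat_inverse V) *\<^sub>v vec d f = (the (mat_inverse V) * V) *\<^sub>v vec d \<kappa>"
    using carr lower_unitriangular_inverse[OF V] by (metis assoc_mult_mat_vec vec_carrier)
  then show ?thesis using lower_unitriangular_inverse[OF V] c by simp
qed

text \<open>Only the upper band and the right recursion appear, so that the locale serves twice: for
  \<open>T\<close> with \<open>B\<close>, and for the transpose of \<open>T\<close> with
  \<open>A\<close>.\<close>

locale recursion_system =
  fixes q :: nat and T :: smat and \<xi> :: "real mat" and B :: "nat \<Rightarrow> nat \<Rightarrow> real poly"
  assumes q: "q \<ge> 1"
    and band: "\<And>n l. n + q < l \<Longrightarrow> T n l = 0"
    and unitriangular: "lower_unitriangular q \<xi>"
    and recursion: "right_recursion_polys q T \<xi> B"
begin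

lemma initial: "b < q \<Longrightarrow> n < q \<Longrightarrow> B b n = [:\<xi> $$ (n, b):]"
  using recursion by (simp add: right_recursion_polys_def)

lemma recurrence:
  "b < q \<Longrightarrow> (\<Sum>l\<le>n + q. Polynomial.smult (T n l) (B b l)) = [:0, 1:] * B b n"
  using recursion unfolding right_recursion_polys_def by blast

text \<open>The rows \<open>n < M\<close> of \<open>x - T\<close>, preceded by \<open>q\<close> unit rows, form a triangular matrix. Multiplied by
  the columns \<open>B\<close> and \<open>M\<close> unit columns it becomes block triangular with the blocks \<open>\<xi>\<close> and
  \<open>x - leading T M\<close>.\<close>

lemma P_poly_eq_det_poly: "P_poly T M = Polynomial.smult (beta q T M) (det_poly q B M M)"
proof -
  define d where "d = M + q"
  define x where "x n j = (if n = j then [:0, 1:] else 0) - [:T n j:]" for n j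
  define X where "X = mat d d (\<lambda>(i, j). if i < q then (if i = j then 1 else 0) else x (i - q) j)"
  define Y where "Y = mat d d (\<lambda>(i, j). if j < q then B j i else if i = j - q then 1 else 0)"
  have carr: "X \<in> carrier_mat d d" "Y \<in> carrier_mat d d" by (simp_all add: X_def Y_def)
  \<comment> \<open>For \<open>n < M\<close> the whole support of row \<open>n\<close> lies below
    \<open>d = M + q\<close>, so the recursion is seen without truncation.\<close>
  have annihilate: "(\<Sum>l<d. x n l * B b l) = 0" if "n < M" "b < q" for n b
  proof -
    have "(\<Sum>l<d. [:T n l:] * B b l) = (\<Sum>l\<le>n + q. [:T n l:] * B b l)"
      using that band by (intro sum.mono_neutral_right) (auto simp: d_def not_le)
    also have "\<dots> = [:0, 1:] * B b n" using recurrence[OF that(2), of n] by simp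
    also have "\<dots> = (\<Sum>l<d. (if n = l then [:0, 1:] else 0) * B b l)"
      using that by (simp add: d_def if_distrib[of "\<lambda>y. y * _"] cong: if_cong)
    finally show ?thesis by (simp add: x_def left_diff_distrib sum_subtractf)
  qed
  define f where "f = (\<lambda>(i, j). if j < q then (if i < q then [:\<xi> $$ (i, j):] else 0)
      else if i < q then (if i = j - q then 1 else 0) else x (i - q) (j - q))"
  have "X * Y = mat (q + M) (q + M) f"
  proof (rule eq_matI)
    fix i j assume "i < dim_row (mat (q + M) (q + M) f)" "j < dim_col (mat (q + M) (q + M) f)"
    then have ij: "i < d" "j < d" by (simp_all add: d_def)
    have XY: "(X * Y) $$ (i, j) = (\<Sum>l<d. (if i < q then (if i = l then 1 else 0) else x (i - q) l) *
        (if j < q then B j l else if l = j - q then 1 else 0))"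
      using ij by (simp add: X_def Y_def scalar_prod_def atLeast0LessThan)
    show "(X * Y) $$ (i, j) = mat (q + M) (q + M) f $$ (i, j)"
    proof (cases "i < q")
      case True
      then have "(X * Y) $$ (i, j) = (if j < q then B j i else if i = j - q then 1 else 0)"
        unfolding XY using ij by (simp add: if_distrib[of "\<lambda>y. y * _"] cong: if_cong)
      then show ?thesis using ij True by (simp add: f_def d_def initial add.commute)
    next
      case False
      then have "i - q < M" "j - q < d" using ij by (auto simp: d_def)
      then show ?thesis unfolding XY using ij False annihilate[of "i - q" j]
        by (simp add: f_def d_def add.commute if_distrib[of "\<lambda>y. _ * y"] cong: if_cong)
    qed
  qed (simp_all add: X_def Y_def d_def)
  then have "det (X * Y) = det (mat q q f) * det (mat M M (\<lambda>(i, j). f (q + i, q + j)))"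
    using det_four_block_lower_left_zero_mat[of q M f] by (simp add: f_def)
  also have "mat M M (\<lambda>(i, j). f (q + i, q + j)) = char_poly_matrix (leading T M)"
    by (rule eq_matI) (auto simp: f_def x_def char_poly_matrix_def leading_def)
  also have "det (mat q q f) = prod_list (diag_mat (mat q q f))"
    using unitriangular
    by (intro det_lower_triangular[of q]) (auto simp: f_def lower_unitriangular_def)
  also have "\<dots> = 1"
    using unitriangular
    by (intro prod_list_neutral) (auto simp: f_def lower_unitriangular_def diag_mat_def)
  finally have detXY: "det X * det Y = P_poly T M"
    using det_mult[OF carr] by (simp add: P_poly_def char_poly_def)
  \<comment> \<open>The upper bandwidth \<open>q\<close> makes \<open>X\<close> lower triangular.
    Row \<open>i \<ge> q\<close> has the diagonal entry \<open>- T (i - q) i\<close>, free of the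
    variable because \<open>q \<ge> 1\<close>.\<close>
  have "det X = prod_list (diag_mat X)"
    using band by (intro det_lower_triangular[of d]) (auto simp: X_def x_def)
  also have "\<dots> = (\<Prod>i<d. if i < q then 1 else - [:T (i - q) i:])"
    unfolding prod_list_diag_prod using q
    by (intro prod.cong) (auto simp: X_def x_def atLeast0LessThan)
  also have "\<dots> = (\<Prod>i\<in>{q..<d}. - [:T (i - q) i:])"
    by (rule prod.mono_neutral_cong_right) auto
  also have "\<dots> = (\<Prod>i<M. - [:T i (q + i):])"
    by (rule prod.reindex_bij_witness[of _ "\<lambda>i. q + i" "\<lambda>i. i - q"]) (auto simp: d_def)
  also have "\<dots> = [:(- 1) ^ M * (\<Prod>i<M. T i (q + i)):]"
    by (induction M) (auto simp: mult_ac)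
  finally have detX: "det X = [:(- 1) ^ M * (\<Prod>i<M. T i (q + i)):]" .
  \<comment> \<open>The \<open>q\<close> columns of polynomials are moved behind the
    \<open>M\<close> unit columns, which leaves an identity block and the rows
    \<open>M, ..., M + q - 1\<close> of the polynomials.\<close>
  have "det Y = (- 1) ^ (M * q) * det (mat (M + q) (M + q) (\<lambda>(i, j).
      Y $$ (i, if j < M then j + q else j - M)))"
    using det_swap_cols[of Y M q] carr unfolding d_def by blast
  also have "det (mat (M + q) (M + q) (\<lambda>(i, j). Y $$ (i, if j < M then j + q else j - M))) =
      det (mat (M + q) (M + q) (\<lambda>(i, j). if j < M then (if i = j then 1 else 0) else B (j - M) i))"
    by (intro arg_cong[of _ _ det] eq_matI) (auto simp: Y_def d_def)
  also have "\<dots> = det (1\<^sub>m M) * det_poly q B M M"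
    unfolding det_poly_def
    by (subst det_four_block_lower_left_zero_mat)
      (auto intro!: arg_cong2[of _ _ _ _ "(*)"] arg_cong[of _ _ det] eq_matI simp del: det_one)
  finally have detY: "det Y = (- 1) ^ (M * q) * det_poly q B M M" by simp
  have sign: "(- 1) ^ (M * q) = [:(- 1) ^ (M * q) :: real:]"
    by (simp add: minus_one_power_iff) (simp add: one_pCons)?
  obtain q' where q': "q = Suc q'" using q by (cases q) auto
  \<comment> \<open>The exponents \<open>M + M * q\<close> and \<open>(q - 1) * M\<close> have the
    same parity.\<close>
  have "(- 1 :: real) ^ M * (- 1) ^ (M * q) = (- 1) ^ ((q - 1) * M)"
    by (simp add: q' power_add[symmetric] mult.commute minus_one_power_iff)
  then have "[:(- 1) ^ M * (\<Prod>i<M. T i (q + i)):] * [:(- 1) ^ (M * q):] = [:beta q T M:]"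
    by (simp add: beta_def mult_ac)
  then have "det X * det Y = [:beta q T M:] * det_poly q B M M"
    unfolding detX detY sign mult.assoc[symmetric] by (rule arg_cong)
  then show ?thesis using detXY by simp
qed

text \<open>The cofactors along the first row do not involve that row; index \<open>0\<close> there
  is a placeholder for \<open>n\<close>.\<close>

definition cof :: "nat \<Rightarrow> nat \<Rightarrow> real poly" where
  "cof N b = cofactor (mat q q (\<lambda>(i, c). B c (if i = 0 then 0 else N + i))) 0 b"

lemma det_poly_expand: "det_poly q B n N = (\<Sum>b<q. B b n * cof N b)"
proof -
  let ?A = "\<lambda>n. mat q q (\<lambda>(i, c). B c (if i = 0 then n else N + i))"
  have "det_poly q B n N = (\<Sum>b<q. ?A n $$ (0, b) * cofactor (?A n) 0 b)"
    unfolding det_poly_def using q by (intro laplace_expansion_row) auto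
  moreover have "mat_delete (?A n) 0 b = mat_delete (?A 0) 0 b" if "b < q" for b
    using that by (intro eq_matI) (auto simp: mat_delete_def)
  ultimately show ?thesis using q by (simp add: cof_def cofactor_def)
qed

text \<open>The determinant is linear in its first row with coefficients independent of
  \<open>n\<close>, so it inherits the recurrence of \<open>B\<close>.\<close>

lemma det_poly_recurrence:
  "(\<Sum>l\<le>n + q. Polynomial.smult (T n l) (det_poly q B l N)) = [:0, 1:] * det_poly q B n N"
proof -
  have "(\<Sum>l\<le>n + q. Polynomial.smult (T n l) (det_poly q B l N)) =
      (\<Sum>b<q. (\<Sum>l\<le>n + q. Polynomial.smult (T n l) (B b l)) * cof N b)"
    unfolding det_poly_expand smult_sum2 sum_distrib_right
    by (subst sum.swap) simp
  also have "\<dots> = (\<Sum>b<q. [:0, 1:] * (B b n * cof N b))"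
    by (rule sum.cong[OF refl]) (simp only: recurrence lessThan_iff mult.assoc)
  finally show ?thesis by (simp only: det_poly_expand sum_distrib_left)
qed

lemma det_poly_zero:
  assumes "N < l" "l < N + q"
  shows "det_poly q B l N = 0"
  unfolding det_poly_def
  by (rule det_identical_rows[of _ q 0 "l - N"]) (use assms in \<open>auto intro!: eq_vecI\<close>)

text \<open>Moving the first row \<open>N + q\<close> behind the rows
  \<open>N + 1, ..., N + q - 1\<close> is a cyclic shift of \<open>q\<close> rows, of sign
  \<open>(- 1) ^ (q - 1)\<close>.\<close>

lemma det_poly_cyclic:
  "det_poly q B (N + q) N = (- 1) ^ (q - 1) * det_poly q B (Suc N) (Suc N)"
proof -
  let ?A = "mat q q (\<lambda>(i, c). B c (if i = 0 then N + q else N + i))"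
  have "det ?A = (- 1) ^ (1 * (q - 1)) * det (mat q q (\<lambda>(i, j).
      ?A $$ (if i < q - 1 then i + 1 else if i < 1 + (q - 1) then i - (q - 1) else i, j)))"
    using q by (intro det_swap_initial_rows) auto
  also have "mat q q (\<lambda>(i, j).
      ?A $$ (if i < q - 1 then i + 1 else if i < 1 + (q - 1) then i - (q - 1) else i, j)) =
      mat q q (\<lambda>(i, c). B c (if i = 0 then Suc N else Suc N + i))"
  proof (rule eq_matI, goal_cases)
    case (1 i j)
    then show ?case using q by (cases "i = q - 1"; cases "q = 1") auto
  qed auto
  finally show ?thesis by (simp add: det_poly_def)
qed

text \<open>The eigenvector components before evaluation at an eigenvalue; keeping the variable
  makes differentiation possible. In the transposed system these are the numerators of
  \<open>w_vec\<close>.\<close>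

definition eigpoly :: "nat \<Rightarrow> nat \<Rightarrow> real poly" where
  "eigpoly N n = Polynomial.smult (beta q T N) (det_poly q B n N)"

lemma eigpoly_last: "eigpoly N N = P_poly T N"
  by (simp add: eigpoly_def P_poly_eq_det_poly)

lemma eigpoly_recurrence:
  "(\<Sum>l\<le>n + q. Polynomial.smult (T n l) (eigpoly N l)) = [:0, 1:] * eigpoly N n"
  using arg_cong[OF det_poly_recurrence[of n N], of "Polynomial.smult (beta q T N)"]
  by (simp add: eigpoly_def smult_sum2 mult.commute)

text \<open>The entry \<open>T N (N + q)\<close> and the sign of the cyclic shift are exactly the
  factors by which \<open>beta q T (Suc N)\<close> exceeds \<open>beta q T N\<close>.\<close>

lemma eigpoly_overflow: "Polynomial.smult (T N (N + q)) (eigpoly N (N + q)) = P_poly T (Suc N)"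
proof -
  have "(- 1) ^ (q - 1) = [:(- 1) ^ (q - 1) :: real:]"
    by (simp add: minus_one_power_iff) (simp add: one_pCons)?
  then have "det_poly q B (N + q) N =
      Polynomial.smult ((- 1) ^ (q - 1)) (det_poly q B (Suc N) (Suc N))"
    by (simp add: det_poly_cyclic)
  moreover have "beta q T (Suc N) = T N (N + q) * beta q T N * (- 1) ^ (q - 1)"
    by (simp add: beta_def power_add mult_ac add.commute)
  ultimately show ?thesis by (simp add: eigpoly_def P_poly_eq_det_poly mult_ac)
qed

text \<open>The components strictly between \<open>N\<close> and \<open>N + q\<close> vanish by
  equal rows, and among the rows \<open>n \<le> N\<close> only row \<open>N\<close> reaches column
  \<open>N + q\<close>. The truncation error is therefore concentrated in the last row.\<close>

lemma eigpoly_truncated: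
  assumes "n \<le> N"
  shows "(\<Sum>l\<le>N. Polynomial.smult (T n l) (eigpoly N l)) + (if n = N then P_poly T (Suc N) else 0)
    = [:0, 1:] * eigpoly N n"
proof -
  have "(\<Sum>l\<le>N + q. Polynomial.smult (T n l) (eigpoly N l)) =
      (\<Sum>l\<le>n + q. Polynomial.smult (T n l) (eigpoly N l))"
    using assms band by (intro sum.mono_neutral_right) (auto simp: not_le)
  also have "{..N + q} = {..N} \<union> ({N<..<N + q} \<union> {N + q})" using q by auto
  also have "(\<Sum>l\<in>\<dots>. Polynomial.smult (T n l) (eigpoly N l)) =
      (\<Sum>l\<le>N. Polynomial.smult (T n l) (eigpoly N l)) +
      Polynomial.smult (T n (N + q)) (eigpoly N (N + q))"
    using q by (subst sum.union_disjoint; (subst sum.union_disjoint)?)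
      (auto simp: eigpoly_def det_poly_zero)
  also have "Polynomial.smult (T n (N + q)) (eigpoly N (N + q)) =
      (if n = N then P_poly T (Suc N) else 0)"
    using assms band[of n "N + q"] by (auto simp: eigpoly_overflow)
  finally show ?thesis by (simp only: eigpoly_recurrence)
qed

lemma eigpoly_eigenvector:
  assumes "n \<le> N" "poly (P_poly T (Suc N)) \<mu> = 0"
  shows "(\<Sum>l\<le>N. T n l * poly (eigpoly N l) \<mu>) = \<mu> * poly (eigpoly N n) \<mu>"
  using arg_cong[OF eigpoly_truncated[OF assms(1)], of "\<lambda>f. poly f \<mu>"] assms(2)
  by (auto simp: poly_sum split: if_splits)

text \<open>Pair \<open>w\<close> with \<open>(x - T) u(x) = P(x) e\<^sub>N\<close>, and with its derivative at the eigenvalue.\<close>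

lemma left_eigenvector_pairing:
  assumes w: "\<And>l. l \<le> N \<Longrightarrow> (\<Sum>n\<le>N. w n * T n l) = \<mu> * w l"
  shows "(x - \<mu>) * (\<Sum>n\<le>N. w n * poly (eigpoly N n) x) = w N * poly (P_poly T (Suc N)) x"
    and "(\<Sum>n\<le>N. w n * poly (eigpoly N n) \<mu>) = w N * poly (pderiv (P_poly T (Suc N))) \<mu>"
proof -
  let ?S = "\<Sum>n\<le>N. Polynomial.smult (w n) (eigpoly N n)"
  have "[:0, 1:] * ?S = (\<Sum>n\<le>N. Polynomial.smult (w n)
      ((\<Sum>l\<le>N. Polynomial.smult (T n l) (eigpoly N l)) + (if n = N then P_poly T (Suc N) else 0)))"
    unfolding sum_distrib_left
    by (rule sum.cong[OF refl]) (simp only: mult_smult_right eigpoly_truncated atMost_iff)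
  also have "\<dots> = (\<Sum>n\<le>N. \<Sum>l\<le>N. Polynomial.smult (w n * T n l) (eigpoly N l)) +
      Polynomial.smult (w N) (P_poly T (Suc N))"
    by (simp add: smult_add_right sum.distrib smult_sum2 if_distrib[of "Polynomial.smult _"]
        cong: if_cong)
  also have "(\<Sum>n\<le>N. \<Sum>l\<le>N. Polynomial.smult (w n * T n l) (eigpoly N l)) =
      (\<Sum>l\<le>N. Polynomial.smult (\<Sum>n\<le>N. w n * T n l) (eigpoly N l))"
    by (subst sum.swap) (simp add: smult_sum)
  also have "\<dots> = Polynomial.smult \<mu> ?S" by (simp add: w smult_sum2)
  finally have eq: "[:- \<mu>, 1:] * ?S = Polynomial.smult (w N) (P_poly T (Suc N))"
    by (simp add: algebra_simps)
  show "(x - \<mu>) * (\<Sum>n\<le>N. w n * poly (eigpoly N n) x) = w N * poly (P_poly T (Suc N)) x"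
    using arg_cong[OF eq, of "\<lambda>f. poly f x"] by (simp add: poly_sum left_diff_distrib)
  \<comment> \<open>Differentiating \<open>(x - \<mu>) * S(x)\<close> and setting
    \<open>x = \<mu>\<close> leaves \<open>S(\<mu>)\<close>.\<close>
  show "(\<Sum>n\<le>N. w n * poly (eigpoly N n) \<mu>) = w N * poly (pderiv (P_poly T (Suc N))) \<mu>"
    using arg_cong[OF eq, of "\<lambda>f. poly (pderiv f) \<mu>"]
    by (simp add: poly_sum pderiv_diff pderiv_smult pderiv_pCons)
qed

text \<open>The factor \<open>t\<close> accommodates both normalizations: \<open>beta\<close> on the
  right, and the quotient of \<open>alpha\<close> by the values of \<open>P_poly\<close> on the
  left.\<close>

lemma christoffel_expansion:
  assumes "c < q"
  shows "(the (mat_inverse \<xi>) *\<^sub>v vec q (\<lambda>n. t * poly (det_poly q B n N) x)) $ c =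
    t * poly (cof N c) x"
  by (rule christoffel_coefficients[OF unitriangular assms])
    (simp add: det_poly_expand poly_sum initial sum_distrib_left mult_ac)

end

section \<open>Left polynomials as right polynomials of the transposed matrix\<close>

lemma recursion_system_right:
  assumes "q \<ge> 1" "positive_banded p q T" "lower_unitriangular q \<xi>" "right_recursion_polys q T \<xi> B"
  shows "recursion_system q T \<xi> B"
  using assms by unfold_locales (auto simp: positive_banded_def)

lemma recursion_system_left:
  assumes "p \<ge> 1" "positive_banded p q T" "lower_unitriangular p \<nu>" "left_recursion_polys p T \<nu> A"
  shows "recursion_system p (\<lambda>i j. T j i) \<nu> A"
  using assms
  by unfold_locales (auto simp: positive_banded_def left_recursion_polys_def right_recursion_polys_def)

lemma P_poly_transpose: "P_poly (\<lambda>i j. T j i) M = P_poly T M"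
proof -
  have "leading (\<lambda>i j. T j i) M = transpose_mat (leading T M)"
    by (rule eq_matI) (auto simp: leading_def)
  then show ?thesis by (simp add: P_poly_def char_poly_transpose_mat[of _ M])
qed

lemma beta_transpose: "beta p (\<lambda>i j. T j i) N = alpha p T N"
  by (simp add: alpha_def beta_def)

section \<open>Spectral representation of the powers\<close>

lemma unit_interval_AE:
  assumes "finite_borel_measure_on_unit_interval M"
  shows "AE x in M. x \<in> {0..1}"
  using assms unfolding finite_borel_measure_on_unit_interval_def
  by (intro AE_I[of _ _ "- {0..1}"]) auto

lemma eigenvalues_eq_roots: "{x. eigenvalue (leading T (Suc N)) x} = {x. poly (P_poly T (Suc N)) x = 0}"
  by (simp add: P_poly_def eigenvalue_root_char_poly[of _ "Suc N"])

lemma P_poly_monic: "degree (P_poly T M) = M" "P_poly T M \<noteq> 0"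
  using degree_monic_char_poly[of "leading T M" M] by (auto simp: P_poly_def)

locale spectral_system =
  R: recursion_system q T \<xi> B + L: recursion_system p "\<lambda>i j. T j i" \<nu> A
  for p q T \<nu> \<xi> A B +
  assumes vd: "\<And>n. variation_diminishing n T"
    and stochastic: "stochastic T"
begin

lemma u_vec_eq: "u_vec q T B N k n = poly (R.eigpoly N n) (lam T N k)"
  by (simp add: u_vec_def R.eigpoly_def)

lemma w_vec_eq: "w_vec p T A N k n = poly (L.eigpoly N n) (lam T N k) /
    (poly (P_poly T N) (lam T N k) * poly (pderiv (P_poly T (Suc N))) (lam T N k))"
  by (simp add: w_vec_def L.eigpoly_def beta_transpose)

lemma christoffel_rho_eq:
  "b < q \<Longrightarrow> christoffel_rho q T \<xi> B N k b = beta q T N * poly (R.cof N b) (lam T N k)"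
  unfolding christoffel_rho_def u_vec_def by (rule R.christoffel_expansion)

lemma christoffel_mu_eq:
  "a < p \<Longrightarrow> christoffel_mu p T \<nu> A N k a = alpha p T N /
     (poly (P_poly T N) (lam T N k) * poly (pderiv (P_poly T (Suc N))) (lam T N k)) *
     poly (L.cof N a) (lam T N k)"
  unfolding christoffel_mu_def w_vec_def times_divide_eq_left[symmetric]
  by (rule L.christoffel_expansion)

text \<open>The expansion along the first row is valid for every \<open>n\<close>, not only for the
  initial indices that define the Christoffel numbers.\<close>

lemma u_vec_christoffel:
  "u_vec q T B N k n = (\<Sum>b<q. poly (B b n) (lam T N k) * christoffel_rho q T \<xi> B N k b)"
  by (simp add: u_vec_def R.det_poly_expand christoffel_rho_eq poly_sum sum_distrib_left mult_ac)

lemma w_vec_christoffel: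
  "w_vec p T A N k m = (\<Sum>a<p. poly (A a m) (lam T N k) * christoffel_mu p T \<nu> A N k a)"
  by (simp add: w_vec_def L.det_poly_expand christoffel_mu_eq poly_sum sum_distrib_left
      sum_divide_distrib mult_ac)

text \<open>The row sums of a truncated stochastic matrix are at most \<open>1\<close>; the
  eigenvalue equation is read at an entry of the eigenvector of largest modulus.\<close>

lemma eigenvalue_bound:
  assumes "poly (P_poly T (Suc N)) x = 0"
  shows "\<bar>x\<bar> \<le> 1"
proof -
  have "eigenvalue (leading T (Suc N)) x" using assms eigenvalues_eq_roots by blast
  then obtain v where v: "v \<in> carrier_vec (Suc N)" "v \<noteq> 0\<^sub>v (Suc N)"
      "leading T (Suc N) *\<^sub>v v = x \<cdot>\<^sub>v v"
    unfolding eigenvalue_def eigenvector_def by (auto simp: leading_def)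
  obtain i0 where i0: "i0 < Suc N" "v $ i0 \<noteq> 0"
    using v(1,2) by (metis carrier_vecD eq_vecI index_zero_vec)
  have "Max ((\<lambda>i. \<bar>v $ i\<bar>) ` {..N}) \<in> (\<lambda>i. \<bar>v $ i\<bar>) ` {..N}"
    by (intro Max_in) auto
  then obtain i where "i \<le> N" and max: "Max ((\<lambda>i. \<bar>v $ i\<bar>) ` {..N}) = \<bar>v $ i\<bar>"
    by (metis (no_types, lifting) imageE atMost_iff)
  then have i: "i \<le> N" "\<And>l. l \<le> N \<Longrightarrow> \<bar>v $ l\<bar> \<le> \<bar>v $ i\<bar>"
    unfolding max[symmetric] by (auto intro!: Max_ge)
  have nonneg: "0 \<le> T i l" for l using stochastic by (simp add: stochastic_def)
  have "(\<Sum>l\<le>N. T i l) \<le> 1"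
    using sum_le_suminf[of "T i" "{..N}"] stochastic nonneg unfolding stochastic_def
    by (auto simp: sums_iff)
  have "x * v $ i = (leading T (Suc N) *\<^sub>v v) $ i" using v(1,3) i(1) by simp
  also have "\<dots> = (\<Sum>l\<le>N. T i l * v $ l)"
    using v(1) i(1) by (simp add: leading_def scalar_prod_def atLeast0LessThan lessThan_Suc_atMost)
  finally have "\<bar>x\<bar> * \<bar>v $ i\<bar> = \<bar>\<Sum>l\<le>N. T i l * v $ l\<bar>" by (simp add: abs_mult[symmetric])
  also have "\<dots> \<le> (\<Sum>l\<le>N. \<bar>T i l * v $ l\<bar>)" by (rule sum_abs)
  also have "\<dots> \<le> (\<Sum>l\<le>N. T i l * \<bar>v $ i\<bar>)"
    using i(2) nonneg by (intro sum_mono) (auto simp: abs_mult intro: mult_left_mono)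
  also have "\<dots> \<le> 1 * \<bar>v $ i\<bar>"
    unfolding sum_distrib_right[symmetric] using \<open>(\<Sum>l\<le>N. T i l) \<le> 1\<close>
    by (intro mult_right_mono) auto
  finally have "\<bar>x\<bar> * \<bar>v $ i\<bar> \<le> 1 * \<bar>v $ i\<bar>" .
  moreover have "0 < \<bar>v $ i\<bar>" using i(2)[of i0] i0 by auto
  ultimately show ?thesis using mult_le_cancel_right_pos by blast
qed

definition positive_at :: "nat \<Rightarrow> bool" where
  "positive_at N \<longleftrightarrow> (\<forall>k\<le>N. (\<forall>b<q. 0 < christoffel_rho q T \<xi> B N k b) \<and>
     (\<forall>a<p. 0 < christoffel_mu p T \<nu> A N k a))"

text \<open>Since \<open>w\<close> is defined by a division and \<open>x / 0 = 0\<close>, a vanishing denominator would make the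
  Christoffel numbers \<open>\<mu>\<close> zero.\<close>

lemma positive_at_nonzero:
  assumes "positive_at N" "k \<le> N"
  shows "poly (P_poly T N) (lam T N k) \<noteq> 0"
    and "poly (pderiv (P_poly T (Suc N))) (lam T N k) \<noteq> 0"
proof -
  have "0 < christoffel_mu p T \<nu> A N k 0"
    using assms L.q unfolding positive_at_def by auto
  then show "poly (P_poly T N) (lam T N k) \<noteq> 0"
      "poly (pderiv (P_poly T (Suc N))) (lam T N k) \<noteq> 0"
    using L.q by (auto simp: christoffel_mu_eq)
qed

text \<open>There are at most \<open>N + 1\<close> roots, so each is \<open>lam T N k\<close> for
  some \<open>k \<le> N\<close> and hence simple by positivity. As all complex roots are real, there
  are exactly \<open>N + 1\<close>, and the list behind \<open>lam\<close> is long enough.\<close>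

lemma lam_bij_betw:
  assumes "positive_at N"
  shows "bij_betw (lam T N) {..N} {x. poly (P_poly T (Suc N)) x = 0}"
proof -
  let ?S = "{x. poly (P_poly T (Suc N)) x = 0}"
  let ?xs = "rev (sorted_list_of_set ?S)"
  have fin: "finite ?S" using P_poly_monic by (intro poly_roots_finite)
  have lam: "lam T N k = ?xs ! k" for k by (simp add: lam_def eigenvalues_eq_roots)
  have xs: "set ?xs = ?S" "length ?xs = card ?S" "distinct ?xs"
    using fin by auto
  have "card ?S \<le> Suc N"
    using card_poly_roots_bound[of "P_poly T (Suc N)"] P_poly_monic[of T "Suc N"] by simp
  have simple: "poly (pderiv (P_poly T (Suc N))) x \<noteq> 0" if "poly (P_poly T (Suc N)) x = 0" for x
  proof -
    have "x \<in> set ?xs" using that xs(1) by simp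
    then obtain k where "k < card ?S" "x = lam T N k"
      unfolding lam in_set_conv_nth xs(2) by blast
    then show ?thesis using positive_at_nonzero(2)[OF assms, of k] \<open>card ?S \<le> Suc N\<close> by simp
  qed
  have "card ?S = degree (P_poly T (Suc N))"
    by (rule card_real_roots_eq_degree[OF _ simple])
      (use char_poly_leading_complex_root_real[OF vd] in \<open>auto simp: P_poly_def\<close>)
  then have "card ?S = Suc N" by (simp add: P_poly_monic)
  then show ?thesis using bij_betw_nth[OF xs(3), of "{..N}" ?S] xs(1,2)
    by (simp add: lam[abs_def] lessThan_Suc_atMost)
qed

text \<open>Off the diagonal, the pairing at a second eigenvalue gives zero. On the diagonal it
  gives the last component of \<open>w\<close> times the derivative of the characteristic
  polynomial, which is \<open>1\<close> because the last component of \<open>eigpoly\<close> is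
  \<open>P_poly T N\<close>.\<close>

lemma biorthonormal:
  assumes pos: "positive_at N" and kl: "k \<le> N" "l \<le> N"
  shows "(\<Sum>n\<le>N. w_vec p T A N k n * u_vec q T B N l n) = (if k = l then 1 else 0)"
proof -
  have root: "poly (P_poly T (Suc N)) (lam T N j) = 0" if "j \<le> N" for j
    using bij_betwE[OF lam_bij_betw[OF pos]] that by simp
  have w: "(\<Sum>n\<le>N. w_vec p T A N k n * T n j) = lam T N k * w_vec p T A N k j" if "j \<le> N" for j
  proof -
    let ?D = "poly (P_poly T N) (lam T N k) * poly (pderiv (P_poly T (Suc N))) (lam T N k)"
    have "(\<Sum>n\<le>N. w_vec p T A N k n * T n j) =
        (\<Sum>n\<le>N. T n j * poly (L.eigpoly N n) (lam T N k)) / ?D"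
      unfolding w_vec_eq sum_divide_distrib
      by (rule sum.cong[OF refl]) (simp only: times_divide_eq_left times_divide_eq_right mult.commute)
    also have "(\<Sum>n\<le>N. T n j * poly (L.eigpoly N n) (lam T N k)) =
        lam T N k * poly (L.eigpoly N j) (lam T N k)"
      using root[OF kl(1)] by (intro L.eigpoly_eigenvector[OF that]) (simp add: P_poly_transpose[of T])
    finally show ?thesis by (simp only: w_vec_eq times_divide_eq_right)
  qed
  note pairing = R.left_eigenvector_pairing[OF w]
  show ?thesis
  proof (cases "k = l")
    case True
    have "w_vec p T A N k N * poly (pderiv (P_poly T (Suc N))) (lam T N k) = 1"
      using L.eigpoly_last[of N] positive_at_nonzero[OF pos kl(1)]
      by (simp add: w_vec_eq P_poly_transpose[of T])
    then show ?thesis using pairing(2) True by (simp add: u_vec_eq)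
  next
    case False
    then have "lam T N l \<noteq> lam T N k"
      using lam_bij_betw[OF pos] kl by (auto simp: bij_betw_def inj_on_def)
    then show ?thesis using pairing(1)[of "lam T N l"] root[OF kl(2)] False by (simp add: u_vec_eq)
  qed
qed

text \<open>A one-sided inverse of a square matrix is two-sided.\<close>

lemma biorthonormal_dual:
  assumes pos: "positive_at N" and nm: "n \<le> N" "m \<le> N"
  shows "(\<Sum>k\<le>N. u_vec q T B N k n * w_vec p T A N k m) = (if n = m then 1 else 0)"
proof -
  define W where "W = mat (Suc N) (Suc N) (\<lambda>(k, n). w_vec p T A N k n)"
  define U where "U = mat (Suc N) (Suc N) (\<lambda>(n, k). u_vec q T B N k n)"
  have WU: "W * U = 1\<^sub>m (Suc N)"
    by (rule eq_matI)
      (auto simp: W_def U_def scalar_prod_def atLeast0LessThan lessThan_Suc_atMost less_Suc_eq_le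
        biorthonormal[OF pos])
  have "U * W = 1\<^sub>m (Suc N)"
    by (rule mat_mult_left_right_inverse[OF _ _ WU]) (auto simp: W_def U_def)
  then have "(U * W) $$ (n, m) = (if n = m then 1 else 0)" using nm by simp
  then show ?thesis
    using nm by (simp add: W_def U_def scalar_prod_def atLeast0LessThan lessThan_Suc_atMost)
qed

section \<open>From powers of the matrix to sums over eigenvalues and integrals\<close>

lemma smat_pow_Suc: "smat_pow T (Suc j) n m = (\<Sum>l\<le>n + q. T n l * smat_pow T j l m)"
  using R.band unfolding smat_pow.simps by (intro smat_mult_finite) (auto simp: not_le)

text \<open>From \<open>n\<close>, \<open>j\<close> steps reach at most \<open>n + j * q\<close>, so
  the truncation is not felt while this stays within \<open>N\<close>. The recurrence for
  \<open>u_vec\<close> is used in its untruncated form.\<close>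

lemma smat_pow_spectral:
  assumes pos: "positive_at N" and m: "m \<le> N"
  shows "n + j * q \<le> N \<Longrightarrow>
    smat_pow T j n m = (\<Sum>k\<le>N. u_vec q T B N k n * lam T N k ^ j * w_vec p T A N k m)"
proof (induction j arbitrary: n)
  case 0
  then show ?case using biorthonormal_dual[OF pos _ m] by (simp add: smat_one_def)
next
  case (Suc j)
  have u: "(\<Sum>l\<le>n + q. T n l * u_vec q T B N k l) = lam T N k * u_vec q T B N k n" for k
    using arg_cong[OF R.eigpoly_recurrence[of n N], of "\<lambda>f. poly f (lam T N k)"]
    by (simp add: u_vec_eq poly_sum)
  have "smat_pow T (Suc j) n m = (\<Sum>l\<le>n + q. T n l *
      (\<Sum>k\<le>N. u_vec q T B N k l * lam T N k ^ j * w_vec p T A N k m))"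
    unfolding smat_pow_Suc using Suc by (intro sum.cong) auto
  also have "\<dots> = (\<Sum>k\<le>N. (\<Sum>l\<le>n + q. T n l * u_vec q T B N k l) *
      lam T N k ^ j * w_vec p T A N k m)"
    unfolding sum_distrib_left sum_distrib_right by (subst sum.swap) (simp add: mult_ac)
  finally show ?case by (simp add: u mult_ac)
qed

lemma integral_discrete_measure:
  assumes pos: "positive_at N" and ba: "b < q" "a < p" and f: "f \<in> borel_measurable borel"
  shows "(\<integral>x. f x \<partial>discrete_measure p q T \<nu> \<xi> A B N b a) =
    (\<Sum>k\<le>N. christoffel_rho q T \<xi> B N k b * christoffel_mu p T \<nu> A N k a * f (lam T N k))"
proof -
  have "(\<integral>x. f x \<partial>discrete_measure p q T \<nu> \<xi> A B N b a) =
      (\<integral>k. f (lam T N k) \<partial>point_measure {..N}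
        (\<lambda>k. ennreal (christoffel_rho q T \<xi> B N k b * christoffel_mu p T \<nu> A N k a)))"
    unfolding discrete_measure_def using f by (intro integral_distr) simp_all
  also have "\<dots> = (\<Sum>k\<le>N. christoffel_rho q T \<xi> B N k b * christoffel_mu p T \<nu> A N k a *
      f (lam T N k))"
    using pos ba by (subst lebesgue_integral_point_measure_finite) (auto simp: positive_at_def less_imp_le)
  finally show ?thesis .
qed

text \<open>Weak convergence tests bounded functions only; the polynomial integrands are frozen outside
  \<open>[-1, 1]\<close>, which contains all eigenvalues and the supports of the limits.\<close>

definition clamp1 :: "real \<Rightarrow> real" where
  "clamp1 x = max (- 1) (min 1 x)"

lemma smat_pow_discrete:
  assumes pos: "positive_at N" and m: "m \<le> N" and n: "n + j * q \<le> N"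
  shows "smat_pow T j n m = (\<Sum>a<p. \<Sum>b<q. \<integral>x. poly (B b n * [:0, 1:] ^ j * A a m) (clamp1 x)
    \<partial>discrete_measure p q T \<nu> \<xi> A B N b a)"
proof -
  let ?x = "\<lambda>k. lam T N k" and ?\<rho> = "\<lambda>k b. christoffel_rho q T \<xi> B N k b"
    and ?\<mu> = "\<lambda>k a. christoffel_mu p T \<nu> A N k a"
  have clamp: "clamp1 (?x k) = ?x k" if "k \<le> N" for k
  proof -
    have "poly (P_poly T (Suc N)) (?x k) = 0"
      using bij_betwE[OF lam_bij_betw[OF pos]] that by simp
    then show ?thesis using eigenvalue_bound[of N "?x k"] by (simp add: clamp1_def abs_le_iff)
  qed
  have meas: "(\<lambda>x. poly P (clamp1 x)) \<in> borel_measurable borel" for P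
    unfolding clamp1_def by (intro borel_measurable_continuous_onI continuous_intros)
  have "(\<integral>x. poly (B b n * [:0, 1:] ^ j * A a m) (clamp1 x)
        \<partial>discrete_measure p q T \<nu> \<xi> A B N b a) =
      (\<Sum>k\<le>N. poly (B b n) (?x k) * ?\<rho> k b * ?x k ^ j * (poly (A a m) (?x k) * ?\<mu> k a))"
    if "a < p" "b < q" for a b
    unfolding integral_discrete_measure[OF pos that(2,1) meas]
    by (rule sum.cong[OF refl]) (simp add: clamp mult_ac)
  then have "(\<Sum>a<p. \<Sum>b<q. \<integral>x. poly (B b n * [:0, 1:] ^ j * A a m) (clamp1 x)
        \<partial>discrete_measure p q T \<nu> \<xi> A B N b a) =
      (\<Sum>a<p. \<Sum>b<q. \<Sum>k\<le>N.
        poly (B b n) (?x k) * ?\<rho> k b * ?x k ^ j * (poly (A a m) (?x k) * ?\<mu> k a))"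
    by simp
  also have "\<dots> = (\<Sum>k\<le>N. \<Sum>a<p. \<Sum>b<q.
        poly (B b n) (?x k) * ?\<rho> k b * ?x k ^ j * (poly (A a m) (?x k) * ?\<mu> k a))"
    by (subst sum.swap, subst (2) sum.swap) simp
  also have "\<dots> = (\<Sum>k\<le>N. u_vec q T B N k n * ?x k ^ j * w_vec p T A N k m)"
    unfolding u_vec_christoffel w_vec_christoffel sum_distrib_right sum_distrib_left ..
  finally show ?thesis using smat_pow_spectral[OF pos m n] by simp
qed

text \<open>Along the subsequence the discrete integrals eventually equal the fixed number
  \<open>smat_pow T j n m\<close>, while weak convergence sends them to the integrals against
  \<open>\<psi>\<close>.\<close>

lemma smat_pow_integral:
  assumes "appropriate_initial_conditions p q T \<nu> \<xi> A B"
    and \<psi>: "spectral_measures p q T \<nu> \<xi> A B \<psi>"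
  shows "smat_pow T j n m =
    (\<Sum>a<p. \<Sum>b<q. LINT x:{0..1}|\<psi> b a. poly (B b n) x * x ^ j * poly (A a m) x)"
proof -
  let ?g = "\<lambda>a b x. poly (B b n * [:0, 1:] ^ j * A a m) (clamp1 x)"
  have pos: "\<forall>\<^sub>F N in sequentially. positive_at N"
    using assms(1) by (simp add: appropriate_initial_conditions_def positive_at_def)
  obtain \<phi> where \<phi>: "strict_mono \<phi>" "\<And>b a. b < q \<Longrightarrow> a < p \<Longrightarrow>
      weak_limit (\<lambda>i. discrete_measure p q T \<nu> \<xi> A B (\<phi> i) b a) (\<psi> b a)"
    using \<psi> unfolding spectral_measures_def by blast
  have cont: "continuous_on UNIV (?g a b)" for a b
    unfolding clamp1_def by (intro continuous_intros)
  have "bounded (range (?g a b))" for a b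
  proof -
    have "compact ((\<lambda>x. poly (B b n * [:0, 1:] ^ j * A a m) x) ` {-1..1})"
      by (intro compact_continuous_image continuous_intros) auto
    moreover have "range (?g a b) \<subseteq> (\<lambda>x. poly (B b n * [:0, 1:] ^ j * A a m) x) ` {-1..1}"
      by (auto simp: clamp1_def)
    ultimately show ?thesis by (meson bounded_subset compact_imp_bounded)
  qed
  then have "(\<lambda>i. \<Sum>a<p. \<Sum>b<q. \<integral>x. ?g a b x \<partial>discrete_measure p q T \<nu> \<xi> A B (\<phi> i) b a)
      \<longlonglongrightarrow> (\<Sum>a<p. \<Sum>b<q. \<integral>x. ?g a b x \<partial>\<psi> b a)"
    using \<phi>(2) cont unfolding weak_limit_def by (intro tendsto_sum) auto
  moreover have "\<forall>\<^sub>F i in sequentially.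
      (\<Sum>a<p. \<Sum>b<q. \<integral>x. ?g a b x \<partial>discrete_measure p q T \<nu> \<xi> A B (\<phi> i) b a) = smat_pow T j n m"
  proof -
    have "\<forall>\<^sub>F N in sequentially. positive_at N \<and> m \<le> N \<and> n + j * q \<le> N"
      using pos eventually_ge_at_top[of m] eventually_ge_at_top[of "n + j * q"]
      by eventually_elim auto
    then have "\<forall>\<^sub>F i in sequentially. positive_at (\<phi> i) \<and> m \<le> \<phi> i \<and> n + j * q \<le> \<phi> i"
      by (rule eventually_subseq[OF \<phi>(1)])
    then show ?thesis by eventually_elim (rule smat_pow_discrete[symmetric]; simp)
  qed
  ultimately have "(\<lambda>i. smat_pow T j n m) \<longlonglongrightarrow> (\<Sum>a<p. \<Sum>b<q. \<integral>x. ?g a b x \<partial>\<psi> b a)"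
    by (rule Lim_transform_eventually)
  then have "smat_pow T j n m = (\<Sum>a<p. \<Sum>b<q. \<integral>x. ?g a b x \<partial>\<psi> b a)"
    by (simp add: LIMSEQ_const_iff)
  \<comment> \<open>\<open>clamp1\<close> is the identity on the unit interval, whose complement is
    a null set.\<close>
  also have "(\<integral>x. ?g a b x \<partial>\<psi> b a) =
      (LINT x:{0..1}|\<psi> b a. poly (B b n) x * x ^ j * poly (A a m) x)" if "a < p" "b < q" for a b
  proof -
    have M: "finite_borel_measure_on_unit_interval (\<psi> b a)"
      using \<psi> that by (simp add: spectral_measures_def)
    then have sets: "sets (\<psi> b a) = sets borel"
      by (simp add: finite_borel_measure_on_unit_interval_def)
    have "?g a b \<in> borel_measurable (\<psi> b a)"
      unfolding measurable_cong_sets[OF sets refl] using cont by (rule borel_measurable_continuous_onI)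
    moreover have "(\<lambda>x. indicator {0..1} x *\<^sub>R (poly (B b n) x * x ^ j * poly (A a m) x))
        \<in> borel_measurable (\<psi> b a)"
      unfolding measurable_cong_sets[OF sets refl]
      by (intro borel_measurable_scaleR borel_measurable_indicator
          borel_measurable_continuous_onI continuous_intros) auto
    ultimately show ?thesis
      unfolding set_lebesgue_integral_def using unit_interval_AE[OF M]
      by (intro integral_cong_AE) (auto simp: clamp1_def elim!: AE_mp)
  qed
  then have "(\<Sum>a<p. \<Sum>b<q. \<integral>x. ?g a b x \<partial>\<psi> b a) =
      (\<Sum>a<p. \<Sum>b<q. LINT x:{0..1}|\<psi> b a. poly (B b n) x * x ^ j * poly (A a m) x)"
    by simp
  finally show ?thesis .
qed

end

section \<open>First passage and renewal\<close>

text \<open>\<open>first_passage T m r n\<close> is \<open>f\<close> with superscript \<open>r + 1\<close> and subscripts \<open>n, m\<close>.\<close>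

primrec first_passage :: "smat \<Rightarrow> nat \<Rightarrow> nat \<Rightarrow> nat \<Rightarrow> real" where
  "first_passage T m 0 n = T n m"
| "first_passage T m (Suc r) n = (\<Sum>l. if l = m then 0 else T n l * first_passage T m r l)"

lemma summable_norm_bounded_powser:
  assumes "\<And>r. \<bar>f r\<bar> \<le> 1" "norm (s :: complex) < 1"
  shows "summable (\<lambda>r. norm (of_real (f r) * s ^ r))"
proof (rule summable_comparison_test')
  show "summable (\<lambda>r. norm s ^ r)" using assms(2) by (simp add: summable_geometric)
  show "norm (norm (of_real (f r) * s ^ r)) \<le> norm s ^ r" if "r \<ge> 0" for r
    using mult_right_mono[OF assms(1)[of r], of "norm s ^ r"] by (simp add: norm_mult norm_power)
qed

locale row_finite_stochastic =
  fixes q :: nat and T :: smat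
  assumes band: "\<And>n l. n + q < l \<Longrightarrow> T n l = 0" and stoch: "stochastic T"
begin

lemma nonneg: "0 \<le> T n l"
  using stoch by (simp add: stochastic_def)

lemma row_sum: "(\<Sum>l\<le>n + q. T n l) = 1"
proof -
  have "(\<lambda>l. T n l) sums (\<Sum>l\<le>n + q. T n l)"
    by (rule sums_finite) (auto simp: band not_le)
  then show ?thesis using stoch sums_unique2 unfolding stochastic_def by blast
qed

lemma smat_mult_row: "smat_mult T R n m = (\<Sum>l\<le>n + q. T n l * R l m)"
  by (rule smat_mult_finite) (auto simp: band not_le)

lemma first_passage_Suc:
  "first_passage T m (Suc r) n = (\<Sum>l\<le>n + q. if l = m then 0 else T n l * first_passage T m r l)"
  unfolding first_passage.simps by (rule suminf_finite) (auto simp: band not_le)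

lemma row_average:
  assumes "\<And>l. 0 \<le> f l \<and> f l \<le> 1"
  shows "0 \<le> (\<Sum>l\<le>n + q. T n l * f l) \<and> (\<Sum>l\<le>n + q. T n l * f l) \<le> 1"
proof -
  have "(\<Sum>l\<le>n + q. T n l * f l) \<le> (\<Sum>l\<le>n + q. T n l * 1)"
    using assms nonneg by (intro sum_mono mult_left_mono) auto
  then show ?thesis using assms nonneg by (auto simp: row_sum intro!: sum_nonneg)
qed

lemma smat_pow_bounds: "0 \<le> smat_pow T r n m \<and> smat_pow T r n m \<le> 1"
proof (induction r arbitrary: n)
  case (Suc r)
  then show ?case using row_average[of "\<lambda>l. smat_pow T r l m" n] by (simp add: smat_mult_row)
qed (simp add: smat_one_def)

lemma first_passage_bounds: "0 \<le> first_passage T m r n \<and> first_passage T m r n \<le> 1"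
proof (induction r arbitrary: n)
  case 0
  have "T n m \<le> 1"
  proof (cases "m \<le> n + q")
    case True
    then have "T n m \<le> (\<Sum>l\<le>n + q. T n l)" by (intro member_le_sum) (auto simp: nonneg)
    then show ?thesis by (simp add: row_sum)
  qed (simp add: band)
  then show ?case by (simp add: nonneg)
next
  case (Suc r)
  have "first_passage T m (Suc r) n = (\<Sum>l\<le>n + q. T n l * (if l = m then 0 else first_passage T m r l))"
    unfolding first_passage_Suc by (rule sum.cong) auto
  then show ?case
    using row_average[of "\<lambda>l. if l = m then 0 else first_passage T m r l" n] Suc by simp
qed

text \<open>Decomposition by the time \<open>i + 1\<close> of the first visit to \<open>m\<close>,
  proved by conditioning on the first step.\<close>

lemma renewal:
  "smat_pow T (Suc r) n m = (\<Sum>i\<le>r. first_passage T m i n * smat_pow T (r - i) m m)"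
proof (induction r arbitrary: n)
  case 0
  have "smat_pow T (Suc 0) n m = (\<Sum>l\<le>n + q. if l = m then T n m else 0)"
    unfolding smat_pow.simps smat_mult_row by (rule sum.cong) (auto simp: smat_one_def)
  then show ?case using band[of n m] by (auto simp: smat_one_def not_le)
next
  case (Suc r)
  let ?g = "\<lambda>l. if l = m then 0 else T n l * smat_pow T (Suc r) l m"
  have split: "T n l * smat_pow T (Suc r) l m =
      (if l = m then T n m * smat_pow T (Suc r) m m else 0) + ?g l" for l
    by auto
  have "smat_pow T (Suc (Suc r)) n m = (\<Sum>l\<le>n + q. T n l * smat_pow T (Suc r) l m)"
    by (subst smat_pow.simps(2)) (rule smat_mult_row)
  also have "\<dots> = (\<Sum>l\<le>n + q. (if l = m then T n m * smat_pow T (Suc r) m m else 0) + ?g l)"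
    by (rule sum.cong[OF refl split])
  \<comment> \<open>A first step into \<open>m\<close> is the term \<open>i = 0\<close>; the other
    first steps shift the passage time by one.\<close>
  also have "\<dots> = T n m * smat_pow T (Suc r) m m + (\<Sum>l\<le>n + q. ?g l)"
    unfolding sum.distrib using band[of n m] by (auto simp: not_le simp del: smat_pow.simps)
  also have "(\<Sum>l\<le>n + q. ?g l) = (\<Sum>l\<le>n + q. \<Sum>i\<le>r.
      (if l = m then 0 else T n l * first_passage T m i l) * smat_pow T (r - i) m m)"
    by (rule sum.cong) (auto simp: Suc sum_distrib_left mult.assoc simp del: smat_pow.simps)
  also have "\<dots> = (\<Sum>i\<le>r. first_passage T m (Suc i) n * smat_pow T (r - i) m m)"
    by (subst sum.swap) (simp only: first_passage_Suc sum_distrib_right)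
  finally show ?case
    by (simp only: sum.atMost_Suc_shift first_passage.simps(1) diff_zero diff_Suc_Suc)
qed

definition first_passage_series :: "complex \<Rightarrow> nat \<Rightarrow> nat \<Rightarrow> complex" where
  "first_passage_series s n m = (\<Sum>r. of_real (first_passage T m r n) * s ^ Suc r)"

text \<open>Both power series converge absolutely, so the renewal convolution becomes a Cauchy
  product. The factor \<open>s\<close> taken out accounts for the index shift in
  \<open>first_passage\<close>.\<close>

lemma renewal_gf:
  assumes s: "norm s < 1"
  shows "transition_gf T s n m =
    (if n = m then 1 else 0) + first_passage_series s n m * transition_gf T s m m"
proof -
  let ?t = "\<lambda>n r. of_real (smat_pow T r n m) * s ^ r"
  let ?f = "\<lambda>r. of_real (first_passage T m r n) * s ^ r"
  have t: "summable (\<lambda>r. norm (?t n r))" for n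
    using smat_pow_bounds s by (intro summable_norm_bounded_powser) auto
  have f: "summable (\<lambda>r. norm (?f r))"
    using first_passage_bounds s by (intro summable_norm_bounded_powser) auto
  have "transition_gf T s n m = ?t n 0 + (\<Sum>r. ?t n (Suc r))"
    unfolding transition_gf_def using suminf_split_head[OF summable_norm_cancel[OF t]] by simp
  also have "?t n 0 = (if n = m then 1 else 0)" by (simp add: smat_one_def)
  also have "(\<lambda>r. ?t n (Suc r)) = (\<lambda>r. s * (\<Sum>i\<le>r. ?f i * ?t m (r - i)))"
  proof
    fix r
    have "?f i * ?t m (r - i) = of_real (first_passage T m i n * smat_pow T (r - i) m m) * s ^ r"
      if "i \<le> r" for i
      using that by (simp add: power_add[symmetric])
    then have "(\<Sum>i\<le>r. ?f i * ?t m (r - i)) = of_real (smat_pow T (Suc r) n m) * s ^ r"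
      unfolding renewal of_real_sum sum_distrib_right by (intro sum.cong) auto
    then show "?t n (Suc r) = s * (\<Sum>i\<le>r. ?f i * ?t m (r - i))" by (simp del: smat_pow.simps)
  qed
  also have "(\<Sum>r. s * (\<Sum>i\<le>r. ?f i * ?t m (r - i))) = s * (\<Sum>r. \<Sum>i\<le>r. ?f i * ?t m (r - i))"
    using summable_Cauchy_product[OF f t[of m]] by (rule suminf_mult)
  also have "(\<Sum>r. \<Sum>i\<le>r. ?f i * ?t m (r - i)) = suminf ?f * suminf (?t m)"
    using Cauchy_product[OF f t[of m]] ..
  also have "s * (suminf ?f * suminf (?t m)) = (s * suminf ?f) * transition_gf T s m m"
    by (simp add: transition_gf_def mult.assoc)
  also have "s * suminf ?f = first_passage_series s n m"
    unfolding first_passage_series_def suminf_mult[OF summable_norm_cancel[OF f], symmetric]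
    by (simp add: mult_ac)
  finally show ?thesis .
qed

text \<open>If it vanished, the renewal equation with \<open>n = m\<close> would read
  \<open>0 = 1\<close>.\<close>

lemma transition_gf_nonzero: "norm s < 1 \<Longrightarrow> transition_gf T s m m \<noteq> 0"
  using renewal_gf[of s m m] by auto

section \<open>Path probabilities of the Markov chain\<close>

lemma path_prob:
  assumes "markov_chain T M X"
  shows "\<P>(\<omega> in M. \<forall>t\<le>Suc r. X t \<omega> = i t) =
    \<P>(\<omega> in M. \<forall>t\<le>r. X t \<omega> = i t) * T (i r) (i (Suc r))"
proof -
  interpret prob_space M using assms by (simp add: markov_chain_def)
  have [measurable]: "X t \<in> measurable M (count_space UNIV)" for t
    using assms by (simp add: markov_chain_def)
  let ?A = "\<P>(\<omega> in M. \<forall>t\<le>r. X t \<omega> = i t)"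
  have eq: "{\<omega> \<in> space M. X (Suc r) \<omega> = i (Suc r) \<and> (\<forall>t\<le>r. X t \<omega> = i t)} =
      {\<omega> \<in> space M. \<forall>t\<le>Suc r. X t \<omega> = i t}"
    by (auto simp: le_Suc_eq)
  show ?thesis
  proof (cases "?A > 0")
    case True
    then have "\<P>(\<omega> in M. X (Suc r) \<omega> = i (Suc r) \<bar> \<forall>t\<le>r. X t \<omega> = i t) = T (i r) (i (Suc r))"
      using assms unfolding markov_chain_def by blast
    then show ?thesis using True unfolding cond_prob_def eq by (simp add: field_simps)
  \<comment> \<open>\<open>markov_chain\<close> prescribes nothing after a path of probability zero;
    there both sides vanish.\<close>
  next
    case False
    then have "?A = 0" using measure_nonneg[of M] by (simp add: less_le)
    moreover have "\<P>(\<omega> in M. \<forall>t\<le>Suc r. X t \<omega> = i t) \<le> ?A"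
      by (intro finite_measure_mono) auto
    ultimately show ?thesis using measure_nonneg[of M] by (simp add: antisym)
  qed
qed

text \<open>The induction prescribes a whole path \<open>i\<close> up to time \<open>r\<close>, because \<open>markov_chain\<close> conditions on
  whole paths only.\<close>

lemma path_first_passage_prob:
  assumes "markov_chain T M X"
  shows "\<P>(\<omega> in M. (\<forall>t\<le>r. X t \<omega> = i t) \<and> X (r + Suc k) \<omega> = m \<and> (\<forall>t\<in>{r<..<r + Suc k}. X t \<omega> \<noteq> m)) =
    \<P>(\<omega> in M. \<forall>t\<le>r. X t \<omega> = i t) * first_passage T m k (i r)"
proof (induction k arbitrary: r i)
  case 0
  have "{\<omega> \<in> space M. (\<forall>t\<le>r. X t \<omega> = i t) \<and> X (r + Suc 0) \<omega> = m \<and> (\<forall>t\<in>{r<..<r + Suc 0}. X t \<omega> \<noteq> m)} =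
      {\<omega> \<in> space M. \<forall>t\<le>Suc r. X t \<omega> = (i(Suc r := m)) t}"
    by (auto simp: le_Suc_eq)
  moreover have "{\<omega> \<in> space M. \<forall>t\<le>r. X t \<omega> = (i(Suc r := m)) t} =
      {\<omega> \<in> space M. \<forall>t\<le>r. X t \<omega> = i t}"
    by auto
  ultimately show ?case using path_prob[OF assms, of r "i(Suc r := m)"] by simp
next
  case (Suc k)
  interpret prob_space M using assms by (simp add: markov_chain_def)
  have [measurable]: "X t \<in> measurable M (count_space UNIV)" for t
    using assms by (simp add: markov_chain_def)
  define E where "E = {\<omega> \<in> space M. (\<forall>t\<le>r. X t \<omega> = i t) \<and> X (r + Suc (Suc k)) \<omega> = m \<and>
    (\<forall>t\<in>{r<..<r + Suc (Suc k)}. X t \<omega> \<noteq> m)}"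
  \<comment> \<open>\<open>E\<close> is split by the state \<open>l\<close> at time
    \<open>Suc r\<close>, which must differ from \<open>m\<close>; each piece prolongs the
    prescribed path by \<open>l\<close>.\<close>
  define F where "F l = {\<omega> \<in> space M. (\<forall>t\<le>r. X t \<omega> = i t) \<and> X (Suc r) \<omega> = l \<and> l \<noteq> m \<and>
    X (Suc r + Suc k) \<omega> = m \<and> (\<forall>t\<in>{Suc r<..<Suc r + Suc k}. X t \<omega> \<noteq> m)}" for l
  let ?P = "\<P>(\<omega> in M. \<forall>t\<le>r. X t \<omega> = i t)"
  have F: "measure M (F l) = ?P * (if l = m then 0 else T (i r) l * first_passage T m k l)" for l
  proof (cases "l = m")
    case False
    let ?j = "i(Suc r := l)"
    have "F l = {\<omega> \<in> space M. (\<forall>t\<le>Suc r. X t \<omega> = ?j t) \<and> X (Suc r + Suc k) \<omega> = m \<and>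
        (\<forall>t\<in>{Suc r<..<Suc r + Suc k}. X t \<omega> \<noteq> m)}"
      using False by (auto simp: F_def le_Suc_eq)
    then have "measure M (F l) = \<P>(\<omega> in M. \<forall>t\<le>Suc r. X t \<omega> = ?j t) * first_passage T m k l"
      using Suc[of "Suc r" ?j] by simp
    moreover have "{\<omega> \<in> space M. \<forall>t\<le>r. X t \<omega> = ?j t} = {\<omega> \<in> space M. \<forall>t\<le>r. X t \<omega> = i t}"
      by auto
    ultimately show ?thesis using path_prob[OF assms, of r ?j] False by simp
  qed (simp add: F_def)
  have "{r<..<r + Suc (Suc k)} = insert (Suc r) {Suc r<..<Suc r + Suc k}" by auto
  then have "E = (\<Union>l. F l)" by (auto simp: E_def F_def)
  moreover have "(\<lambda>l. measure M (F l)) sums measure M (\<Union>l. F l)"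
  proof (rule finite_measure_UNION)
    show "range F \<subseteq> sets M" unfolding F_def by auto
    show "disjoint_family F" unfolding F_def disjoint_family_on_def by auto
  qed
  ultimately have "measure M E = (\<Sum>l. measure M (F l))" using sums_unique by metis
  also have "\<dots> = (\<Sum>l\<le>i r + q. measure M (F l))"
    by (rule suminf_finite) (auto simp: F band not_le)
  also have "\<dots> = ?P * first_passage T m (Suc k) (i r)"
    unfolding F first_passage_Suc sum_distrib_left ..
  finally show ?case by (simp only: E_def)
qed

lemma first_passage_prob_eq:
  assumes "markov_chain T M X" and pos: "\<P>(\<omega> in M. X 0 \<omega> = n) > 0"
  shows "first_passage_prob M X (Suc r) n m = first_passage T m r n"
proof -
  have "{\<omega> \<in> space M. (X (Suc r) \<omega> = m \<and> (\<forall>t\<in>{1..<Suc r}. X t \<omega> \<noteq> m)) \<and> X 0 \<omega> = n} =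
      {\<omega> \<in> space M. (\<forall>t\<le>0. X t \<omega> = n) \<and> X (0 + Suc r) \<omega> = m \<and> (\<forall>t\<in>{0<..<0 + Suc r}. X t \<omega> \<noteq> m)}"
    by (auto simp: Suc_le_eq)
  then show ?thesis
    using path_first_passage_prob[OF assms(1), of 0 "\<lambda>_. n" r m] pos
    by (simp add: first_passage_prob_def cond_prob_def)
qed

lemma first_passage_gf_eq:
  assumes "markov_chain T M X" "\<P>(\<omega> in M. X 0 \<omega> = n) > 0"
  shows "first_passage_gf M X s n m = first_passage_series s n m"
  by (simp add: first_passage_gf_def first_passage_series_def first_passage_prob_eq[OF assms])

end

section \<open>Integration over the unit interval and the geometric series\<close>

lemma integrable_continuous_unit_interval:
  fixes f :: "real \<Rightarrow> complex"
  assumes M: "finite_borel_measure_on_unit_interval M" and f: "continuous_on {0..1} f"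
  shows "set_integrable M {0..1} f"
proof -
  have sets: "sets M = sets borel" and fin: "finite_measure M"
    using M by (auto simp: finite_borel_measure_on_unit_interval_def)
  interpret finite_measure M by (rule fin)
  have "compact (f ` {0..1})" using f by (intro compact_continuous_image) auto
  then obtain C where "\<forall>y\<in>f ` {0..1}. norm y \<le> C"
    using compact_imp_bounded bounded_iff by metis
  then have C: "norm (f x) \<le> C" if "x \<in> {0..1}" for x
    using that by simp
  have "C \<ge> 0" using order_trans[OF norm_ge_zero C[of 0]] by simp
  show ?thesis
    unfolding set_integrable_def
  proof (rule integrable_const_bound[of _ C])
    show "AE x in M. norm (indicator {0..1} x *\<^sub>R f x) \<le> C"
      using C \<open>C \<ge> 0\<close> by (intro AE_I2) (simp add: indicator_def)
    show "(\<lambda>x. indicator {0..1} x *\<^sub>R f x) \<in> borel_measurable M"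
      unfolding measurable_cong_sets[OF sets refl]
      using f by (intro borel_measurable_continuous_on_indicator) auto
  qed
qed

text \<open>On the unit interval the \<open>r\<close>-th term is bounded by
  \<open>norm s ^ r\<close> times the integrable \<open>\<bar>f x * g x\<bar>\<close>, which permits
  termwise integration of the geometric series in \<open>s * x\<close>.\<close>

lemma stieltjes_sums:
  fixes f g :: "real \<Rightarrow> real"
  assumes M: "finite_borel_measure_on_unit_interval M"
    and f: "continuous_on {0..1} f" and g: "continuous_on {0..1} g" and s: "norm (s :: complex) < 1"
  shows "(\<lambda>r. of_real (LINT x:{0..1}|M. f x * x ^ r * g x) * s ^ r) sums
    (LINT x:{0..1}|M. of_real (f x) * (1 / (1 - s * of_real x)) * of_real (g x))"
proof -
  define h :: "nat \<Rightarrow> real \<Rightarrow> complex"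
    where "h r x = indicator {0..1} x *\<^sub>R (of_real (f x * x ^ r * g x) * s ^ r)" for r x
  define H where "H x = indicator {0..1} x * \<bar>f x * g x\<bar>" for x :: real
  have H: "integrable M H"
  proof -
    have "set_integrable M {0..1} (\<lambda>x. of_real (f x * g x) :: complex)"
      using f g by (intro integrable_continuous_unit_interval[OF M] continuous_intros)
    then have "integrable M (\<lambda>x. norm (indicator {0..1} x *\<^sub>R (of_real (f x * g x) :: complex)))"
      unfolding set_integrable_def by (rule integrable_norm)
    then show ?thesis by (simp add: H_def[abs_def] norm_mult abs_mult)
  qed
  have h: "integrable M (h r)" for r
    using integrable_continuous_unit_interval[OF M, of "\<lambda>x. of_real (f x * x ^ r * g x) * s ^ r"] f g
    unfolding h_def[abs_def] set_integrable_def by (simp add: continuous_intros)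
  have bound: "norm (h r x) \<le> norm s ^ r * H x" for r x
  proof (cases "x \<in> {0..1}")
    case True
    then have "\<bar>x ^ r\<bar> \<le> 1" by (simp add: power_le_one)
    then have "\<bar>f x * g x\<bar> * \<bar>x ^ r\<bar> * norm s ^ r \<le> \<bar>f x * g x\<bar> * 1 * norm s ^ r"
      by (intro mult_right_mono mult_left_mono) auto
    then show ?thesis using True by (simp add: h_def H_def norm_mult norm_power abs_mult mult_ac)
  qed (simp add: h_def H_def)
  have geo: "summable (\<lambda>r. norm s ^ r)" using s by (simp add: summable_geometric)
  have "(\<lambda>r. integral\<^sup>L M (h r)) sums (\<integral>x. (\<Sum>r. h r x) \<partial>M)"
  proof (rule sums_integral)
    show "integrable M (h r)" for r by (rule h)
    show "AE x in M. summable (\<lambda>r. norm (h r x))"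
      by (intro AE_I2 summable_comparison_test'[OF summable_mult2[OF geo]]) (use bound in auto)
    have "norm (\<integral>x. norm (h r x) \<partial>M) \<le> norm s ^ r * integral\<^sup>L M H" for r
    proof -
      have "(\<integral>x. norm (h r x) \<partial>M) \<le> (\<integral>x. norm s ^ r * H x \<partial>M)"
        using bound h H by (intro integral_mono integrable_norm) auto
      then show ?thesis by simp
    qed
    then show "summable (\<lambda>r. \<integral>x. norm (h r x) \<partial>M)"
      by (intro summable_comparison_test'[OF summable_mult2[OF geo]]) auto
  qed
  moreover have "integral\<^sup>L M (h r) = of_real (LINT x:{0..1}|M. f x * x ^ r * g x) * s ^ r" for r
  proof -
    have "h r = (\<lambda>x. of_real (indicator {0..1} x *\<^sub>R (f x * x ^ r * g x)) * s ^ r)"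
      by (rule ext) (simp add: h_def indicator_def)
    then show ?thesis unfolding set_lebesgue_integral_def by (simp only: integral_mult_left_zero integral_complex_of_real)
  qed
  moreover have "(\<Sum>r. h r x) =
      indicator {0..1} x *\<^sub>R (of_real (f x) * (1 / (1 - s * of_real x)) * of_real (g x))" for x
  proof (cases "x \<in> {0..1}")
    case True
    have "norm (s * of_real x) < 1"
      using True s mult_left_le[of x "norm s"] by (simp add: norm_mult)
    then have "(\<lambda>r. of_real (f x) * (s * of_real x) ^ r * of_real (g x)) sums
        (of_real (f x) * (1 / (1 - s * of_real x)) * of_real (g x))"
      by (intro sums_mult sums_mult2 geometric_sums)
    then show ?thesis using True
      by (simp add: h_def sums_iff power_mult_distrib mult_ac)
  qed (simp add: h_def)
  ultimately show ?thesis by (simp add: set_lebesgue_integral_def)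
qed

section \<open>The four formulas for the chain\<close>

theorem theorem2p19:
  fixes p q :: nat
    and T :: smat
    and \<nu> \<xi> :: "real mat"
    and A B :: "nat \<Rightarrow> nat \<Rightarrow> real poly"
    and \<psi> :: "nat \<Rightarrow> nat \<Rightarrow> real measure"
  assumes "p \<ge> 1" and "q \<ge> 1"
    and "stochastic T"
    and "positive_banded p q T"
    and "positive_bidiagonal_factorization p q T"
    and "lower_unitriangular p \<nu>" and "lower_unitriangular q \<xi>"
    and "left_recursion_polys p T \<nu> A" and "right_recursion_polys q T \<xi> B"
    and "appropriate_initial_conditions p q T \<nu> \<xi> A B"
    and "spectral_measures p q T \<nu> \<xi> A B \<psi>"
  shows "(\<forall>k n m. smat_pow T k n m =
            (\<Sum>a<p. \<Sum>b<q. LINT x:{0..1}|\<psi> b a. poly (B b n) x * x ^ k * poly (A a m) x))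
       \<and> (\<forall>s n m. norm s < 1 \<longrightarrow> transition_gf T s n m = stieltjes_sum p q A B \<psi> s n m)
       \<and> (\<forall>(M :: 'w measure) X s n m.
            markov_chain T M X \<longrightarrow> \<P>(\<omega> in M. X 0 \<omega> = n) > 0 \<longrightarrow> norm s < 1 \<longrightarrow> n \<noteq> m \<longrightarrow>
            first_passage_gf M X s n m =
              stieltjes_sum p q A B \<psi> s n m / stieltjes_sum p q A B \<psi> s m m)
       \<and> (\<forall>(M :: 'w measure) X s m.
            markov_chain T M X \<longrightarrow> \<P>(\<omega> in M. X 0 \<omega> = m) > 0 \<longrightarrow> norm s < 1 \<longrightarrow>
            first_passage_gf M X s m m = 1 - 1 / stieltjes_sum p q A B \<psi> s m m)"
proof -
  interpret spectral_system p q T \<nu> \<xi> A B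
    using assms positive_bidiagonal_factorization_variation_diminishing
    by (intro spectral_system.intro recursion_system_right recursion_system_left
        spectral_system_axioms.intro) auto
  interpret row_finite_stochastic q T
    using R.band stochastic by unfold_locales
  have pow: "smat_pow T k n m =
      (\<Sum>a<p. \<Sum>b<q. LINT x:{0..1}|\<psi> b a. poly (B b n) x * x ^ k * poly (A a m) x)" for k n m
    using assms by (intro smat_pow_integral) auto
  have gf: "transition_gf T s n m = stieltjes_sum p q A B \<psi> s n m" if s: "norm s < 1" for s n m
  proof -
    have "(\<lambda>k. \<Sum>a<p. \<Sum>b<q.
        of_real (LINT x:{0..1}|\<psi> b a. poly (B b n) x * x ^ k * poly (A a m) x) * s ^ k)
        sums stieltjes_sum p q A B \<psi> s n m"
      unfolding stieltjes_sum_def using assms(11) s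
      by (intro sums_sum stieltjes_sums continuous_intros) (auto simp: spectral_measures_def)
    then have "(\<lambda>k. of_real (smat_pow T k n m) * s ^ k) sums stieltjes_sum p q A B \<psi> s n m"
      by (simp only: pow of_real_sum sum_distrib_right)
    then show ?thesis by (simp add: transition_gf_def sums_iff)
  qed
  \<comment> \<open>The renewal equation solved for the first passage series, its factor
    \<open>transition_gf T s m m\<close> being nonzero.\<close>
  have fp: "first_passage_gf M X s n m =
      (transition_gf T s n m - (if n = m then 1 else 0)) / transition_gf T s m m"
    if "markov_chain T M X" "\<P>(\<omega> in M. X 0 \<omega> = n) > 0" "norm s < 1"
    for M :: "'w measure" and X s n m
    using renewal_gf[OF that(3), of n m] transition_gf_nonzero[OF that(3), of m]
    by (simp add: first_passage_gf_eq[OF that(1,2)] field_simps)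
  show ?thesis
  proof (intro conjI allI impI)
    fix M :: "'w measure" and X and s :: complex and n m
    assume *: "markov_chain T M X" "\<P>(\<omega> in M. X 0 \<omega> = n) > 0" "norm s < 1" "n \<noteq> m"
    show "first_passage_gf M X s n m =
        stieltjes_sum p q A B \<psi> s n m / stieltjes_sum p q A B \<psi> s m m"
      using fp[OF *(1-3), of m] *(3,4) by (simp add: gf)
  next
    fix M :: "'w measure" and X and s :: complex and m
    assume *: "markov_chain T M X" "\<P>(\<omega> in M. X 0 \<omega> = m) > 0" "norm s < 1"
    show "first_passage_gf M X s m m = 1 - 1 / stieltjes_sum p q A B \<psi> s m m"
      using fp[OF *, of m] transition_gf_nonzero[OF *(3), of m] *(3)
      by (simp add: gf diff_divide_distrib)
  qed (use pow gf in auto)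
qed

end
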